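(* Let $V$ be a vector space of dimension $n$ over $\mathbb{F}_q$, where $n\geq 3$ is odd and $q$ is a power of $2$. Let $\mathcal{M}$ be a $2n$-dimensional $\mathbb{F}_q$-subspace of $\mathrm{Symm}(V)$ in which the rank of each non-zero element is at least $n-2$. Then $\mathcal{M}_{\mathrm{Alt}}$ is an $n$-dimensional constant rank $n-1$ subspace. Furthermore, provided that $q\geq n-1$, the dimension of a constant rank $n-2$ subspace of $\mathcal{M}$ is at most $(2n-3)/3$.
   Context: $\mathbb{F}_q$ is the field of order $q$. $\mathrm{Symm}(V)$ denotes the $\mathbb{F}_q$-vector space of all symmetric bilinear forms $f:V\times V\to\mathbb{F}_q$. The radical of $f$ is $\mathrm{rad} f=\{u\in V: f(u,v)=0\text{ for all }v\in V\}$ and $\mathrm{rank} f=\dim V-\dim\mathrm{rad} f$. $\mathcal{M}_{\mathrm{Alt}}$ is the subspace of alternating forms in $\mathcal{M}$ (those with $f(u,u)=0$ for all $u\in V$). A constant rank $k$ subspace is a non-zero subspace all of whose non-zero elements have rank $k$. *)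

theory Defs
  imports Complex_Main "HOL-Library.Function_Algebras"
begin

(* A vector space V over the field 'k is given by its scalar multiplication scale;
   the carrier of V is the whole type 'v. Forms on V live in the function type
   'v => 'v => 'k, whose additive structure is the pointwise one. *)

definition form_scale :: "'k::field \<Rightarrow> ('v \<Rightarrow> 'v \<Rightarrow> 'k) \<Rightarrow> ('v \<Rightarrow> 'v \<Rightarrow> 'k)"
  where "form_scale c f = (\<lambda>u v. c * f u v)"

global_interpretation form: vector_space form_scale
  by unfold_locales (simp_all add: form_scale_def fun_eq_iff algebra_simps)

definition bilinear_form ::
    "('k::field \<Rightarrow> 'v::ab_group_add \<Rightarrow> 'v) \<Rightarrow> ('v \<Rightarrow> 'v \<Rightarrow> 'k) \<Rightarrow> bool"
  where "bilinear_form scale f \<longleftrightarrow>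
    (\<forall>u. Vector_Spaces.linear scale (*) (\<lambda>v. f u v)) \<and>
    (\<forall>v. Vector_Spaces.linear scale (*) (\<lambda>u. f u v))"

definition Symm :: "('k::field \<Rightarrow> 'v::ab_group_add \<Rightarrow> 'v) \<Rightarrow> ('v \<Rightarrow> 'v \<Rightarrow> 'k) set"
  where "Symm scale = {f. bilinear_form scale f \<and> (\<forall>u v. f u v = f v u)}"

definition form_radical :: "('v \<Rightarrow> 'v \<Rightarrow> 'k::zero) \<Rightarrow> 'v set"
  where "form_radical f = {u. \<forall>v. f u v = 0}"

definition form_rank ::
    "('k::field \<Rightarrow> 'v::ab_group_add \<Rightarrow> 'v) \<Rightarrow> ('v \<Rightarrow> 'v \<Rightarrow> 'k) \<Rightarrow> nat"
  where "form_rank scale f =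
    vector_space.dim scale (UNIV :: 'v set) - vector_space.dim scale (form_radical f)"

definition alternating_part :: "('v \<Rightarrow> 'v \<Rightarrow> 'k::zero) set \<Rightarrow> ('v \<Rightarrow> 'v \<Rightarrow> 'k) set"
  where "alternating_part M = {f \<in> M. \<forall>u. f u u = 0}"

definition constant_rank_subspace ::
    "('k::field \<Rightarrow> 'v::ab_group_add \<Rightarrow> 'v) \<Rightarrow> nat \<Rightarrow> ('v \<Rightarrow> 'v \<Rightarrow> 'k) set \<Rightarrow> bool"
  where "constant_rank_subspace scale k U \<longleftrightarrow>
    form.subspace U \<and> U \<subseteq> Symm scale \<and> U \<noteq> {0} \<and>
    (\<forall>f\<in>U. f \<noteq> 0 \<longrightarrow> form_rank scale f = k)"

end

theory Submission
  imports Defs "HOL-Library.FuncSet" "HOL-Library.Cardinality"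
begin

text \<open>
  Let \<open>q\<close> be the order of the field and \<open>N = q ^ n\<close>. Say that a form \<open>f\<close> kills \<open>u\<close> when \<open>f u = 0\<close>,
  that is, when \<open>u\<close> lies in the radical of \<open>f\<close>. The proof counts pairs of forms and vectors.

  The alternating part. In characteristic 2 the map sending \<open>f\<close> to its diagonal \<open>u \<mapsto> f u u\<close> is linear
  and its values are squares of linear functionals, of which there are \<open>N\<close>. Its kernel is the alternating
  part \<open>A\<close> of \<open>M\<close>, so \<open>A\<close> has at least \<open>N\<close> elements. Alternating forms have even rank and \<open>n\<close> is odd, so
  the non-zero elements of \<open>A\<close> have rank \<open>n - 1\<close>, and each kills the \<open>q\<close> vectors of a line. For \<open>u \<noteq> 0\<close>
  the map \<open>f \<mapsto> f u\<close> sends \<open>A\<close> into the \<open>N / q\<close> functionals that vanish at \<open>u\<close>, so at least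
  \<open>card A * q / N\<close> forms of \<open>A\<close> kill \<open>u\<close>. Summing over \<open>u\<close> leaves only \<open>card A = N\<close>, and then exactly \<open>q\<close>
  forms of \<open>A\<close> kill a given \<open>u \<noteq> 0\<close> (\<open>card_alternating_part\<close>, \<open>card_alternating_killing\<close>). Consequently
  exactly \<open>N\<close> forms of \<open>M\<close> kill a given \<open>u \<noteq> 0\<close> (\<open>card_M_killing\<close>).

  The key fact for the second claim is that two independent vectors \<open>u\<close>, \<open>w\<close> are killed by exactly \<open>q\<close>
  forms of \<open>M\<close> (\<open>card_two_killing\<close>). Comparing dimensions gives at least \<open>q\<close>. For the opposite inequality
  choose \<open>c\<close> such that \<open>X\<^sup>2 + X + c\<close> has no root and consider the expression
  \<open>f x x + f x y + c * f y y\<close>. For fixed \<open>f\<close> it has a number of zeros \<open>(x, y)\<close> that depends only on the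
  rank \<open>r\<close> of \<open>f\<close>, and deviates from the average by a term of sign \<open>(-1) ^ r\<close> (\<open>card_elliptic_zeros\<close>).
  For fixed \<open>(x, y)\<close> it is a linear functional of \<open>f\<close>, so it vanishes on at least the \<open>q\<close>-th part of any
  space of forms. The forms that kill \<open>u\<close> have the even rank \<open>n - 1\<close> or the odd rank \<open>n - 2\<close>; the two
  counts together bound the number of those of rank \<open>n - 2\<close> (\<open>corank_two_count_le\<close>), which is what the
  sum over \<open>w\<close> needs.

  Let finally \<open>U\<close> have constant rank \<open>n - 2\<close> and \<open>q \<ge> n - 1\<close>. Then the radical of each non-zero element
  of \<open>U\<close> is isotropic for all of \<open>U\<close>; otherwise a pencil in \<open>U\<close> would produce \<open>q\<close> eigenvectors with distinct
  eigenvalues in a space of dimension \<open>n - 2\<close> (\<open>radical_isotropic_in_pencil\<close>). So the radicals lie in the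
  set \<open>W\<close> of common isotropic vectors, and \<open>card W * card U = N\<close> because \<open>U\<close> contains no non-zero
  alternating form. By the key fact a plane in \<open>W\<close> is the radical of at most \<open>q - 1\<close> elements of \<open>U\<close>. Hence at
  most \<open>card W / q\<close> forms of \<open>U\<close>, the zero form included, kill a given non-zero \<open>u\<close> in \<open>W\<close>, and counting
  once more gives
  \<open>(card U - 1) * (q\<^sup>2 - 1) \<le> (card W - 1) * (card W / q - 1)\<close>, which forces \<open>3 * dim U + 3 \<le> 2 * n\<close>.
\<close>

section \<open>Counting in vector spaces over a finite field\<close>

lemma card_eq_card_kernel_times_card_image:
  fixes h :: "'a::ab_group_add \<Rightarrow> 'b::ab_group_add"
  assumes fin: "finite A"
    and diff: "\<And>x y. x \<in> A \<Longrightarrow> y \<in> A \<Longrightarrow> x - y \<in> A"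
    and add: "\<And>x y. x \<in> A \<Longrightarrow> y \<in> A \<Longrightarrow> x + y \<in> A"
    and hom: "\<And>x y. x \<in> A \<Longrightarrow> y \<in> A \<Longrightarrow> h (x + y) = h x + h y"
  shows "card A = card {x \<in> A. h x = 0} * card (h ` A)"
proof -
  have hdiff: "h (x - y) = h x - h y" if "x \<in> A" "y \<in> A" for x y
    using hom[of "x - y" y] diff that by (simp add: algebra_simps)
  have fibre: "card {x \<in> A. h x = y} = card {x \<in> A. h x = 0}" if y: "y \<in> h ` A" for y
  proof -
    obtain x0 where x0: "x0 \<in> A" "y = h x0" using y by blast
    have "bij_betw (\<lambda>x. x - x0) {x \<in> A. h x = y} {x \<in> A. h x = 0}"
      by (rule bij_betw_byWitness[where f' = "\<lambda>x. x + x0"])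
        (use x0 diff add hom hdiff in auto)
    then show ?thesis by (rule bij_betw_same_card)
  qed
  have "card A = (\<Sum>y\<in>h ` A. card {x \<in> A. h x = y})"
    using sum.image_gen[OF fin, of "\<lambda>_. 1::nat" h] by simp
  then show ?thesis using fibre by simp
qed

lemma sum_card_swap:
  assumes "finite A" "finite B"
  shows "(\<Sum>a\<in>A. card {b \<in> B. P a b}) = (\<Sum>b\<in>B. card {a \<in> A. P a b})"
  using sum_multicount_gen[OF assms, of P "\<lambda>b. card {a \<in> A. P a b}"] by simp

lemma sum_le_imp_eq_lower_bound:
  fixes g :: "'a \<Rightarrow> nat"
  assumes "finite A" and lower: "\<And>x. x \<in> A \<Longrightarrow> c \<le> g x"
    and upper: "(\<Sum>x\<in>A. g x) \<le> card A * c" and "a \<in> A"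
  shows "g a = c"
proof (rule ccontr)
  assume "g a \<noteq> c"
  then have "c < g a" using lower[OF \<open>a \<in> A\<close>] by simp
  then have "(\<Sum>x\<in>A. c) < (\<Sum>x\<in>A. g x)"
    by (intro sum_strict_mono_ex1) (use assms in auto)
  then show False using upper by simp
qed

locale finite_field_space = vector_space scale
  for scale :: "'k::{field, finite} \<Rightarrow> 'v::ab_group_add \<Rightarrow> 'v"
begin

lemma q_ge_2: "CARD('k) \<ge> 2"
proof -
  have "card {0, 1 :: 'k} \<le> CARD('k)" by (rule card_mono) auto
  then show ?thesis by simp
qed

lemma card_span:
  assumes ind: "independent B" and fin: "finite B"
  shows "finite (span B) \<and> card (span B) = CARD('k) ^ card B"
proof -
  let ?F = "B \<rightarrow>\<^sub>E (UNIV :: 'k set)"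
  let ?h = "\<lambda>u. \<Sum>b\<in>B. scale (u b) b"
  have "?h ` ?F = span B"
  proof
    show "?h ` ?F \<subseteq> span B"
      by (rule image_subsetI, rule span_sum, rule span_scale, erule span_base)
    show "span B \<subseteq> ?h ` ?F"
    proof
      fix x assume "x \<in> span B"
      then obtain u where u: "x = ?h u" unfolding span_finite[OF fin] by (rule imageE)
      have "x = ?h (restrict u B)" unfolding u by (rule sum.cong) auto
      then show "x \<in> ?h ` ?F" by (rule image_eqI[where x = "restrict u B"]) simp
    qed
  qed
  moreover have "inj_on ?h ?F"
  proof (rule inj_onI)
    fix u v assume uv: "u \<in> ?F" "v \<in> ?F" "?h u = ?h v"
    have "(\<Sum>b\<in>B. scale (u b - v b) b) = 0"
      using uv(3) by (simp add: scale_left_diff_distrib sum_subtractf)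
    then have "u b = v b" if "b \<in> B" for b
      using independentD[OF ind fin order_refl, of "\<lambda>b. u b - v b" b] that by simp
    then show "u = v" using uv by (intro PiE_ext) auto
  qed
  ultimately have bij: "bij_betw ?h ?F (span B)" by (simp only: bij_betw_def)
  have "finite ?F" using fin by (intro finite_PiE) auto
  moreover have "card ?F = CARD('k) ^ card B" using fin by (simp add: card_funcsetE)
  ultimately show ?thesis using bij_betw_finite[OF bij] bij_betw_same_card[OF bij] by simp
qed

lemma card_subspace:
  assumes sub: "subspace S" and "finite S \<or> dim S > 0"
  shows "finite S \<and> card S = CARD('k) ^ dim S"
proof -
  obtain B where B: "B \<subseteq> S" "independent B" "S \<subseteq> span B" "card B = dim S"
    using basis_exists[of S] by blast
  have "finite B" using B assms(2) by (metis card_gt_0_iff finite_subset)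
  moreover have "span B = S" using B sub span_minimal by blast
  ultimately show ?thesis using card_span[OF B(2)] B(4) by auto
qed

lemma card_level_surj:
  assumes sub: "subspace W" and fin: "finite W"
    and add: "\<And>x y. x \<in> W \<Longrightarrow> y \<in> W \<Longrightarrow> \<phi> (x + y) = \<phi> x + \<phi> y"
    and scl: "\<And>c x. x \<in> W \<Longrightarrow> \<phi> (scale c x) = \<sigma> c * \<phi> x"
    and sur: "surj \<sigma>" and w: "w \<in> W" "\<phi> w \<noteq> (0::'k)"
  shows "card W = CARD('k) * card {x \<in> W. \<phi> x = 0}"
proof -
  have "\<phi> ` W = UNIV"
  proof -
    have "a \<in> \<phi> ` W" for a
    proof -
      obtain c where "\<sigma> c = a / \<phi> w" using sur by (metis surjD)
      then have "\<phi> (scale c w) = a" using scl[OF w(1)] w(2) by simp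
      then show ?thesis using w(1) sub by (metis imageI subspace_scale)
    qed
    then show ?thesis by blast
  qed
  then show ?thesis
    using card_eq_card_kernel_times_card_image[OF fin, of \<phi>] add sub
    by (simp add: subspace_add subspace_diff mult.commute)
qed

lemma card_le_level:
  assumes sub: "subspace W" and fin: "finite W"
    and add: "\<And>x y. x \<in> W \<Longrightarrow> y \<in> W \<Longrightarrow> \<phi> (x + y) = \<phi> x + \<phi> y"
    and scl: "\<And>c x. x \<in> W \<Longrightarrow> \<phi> (scale c x) = c * \<phi> x"
  shows "card W \<le> CARD('k) * card {x \<in> W. \<phi> x = (0::'k)}"
proof (cases "\<forall>w\<in>W. \<phi> w = 0")
  case True
  then have "{x \<in> W. \<phi> x = 0} = W" by auto
  then show ?thesis using q_ge_2 by simp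
next
  case False
  then obtain w where "w \<in> W" "\<phi> w \<noteq> 0" by blast
  then have "card W = CARD('k) * card {x \<in> W. \<phi> x = 0}"
    by (intro card_level_surj[OF sub fin, where \<sigma> = "\<lambda>c. c" and w = w]) (simp_all add: add scl)
  then show ?thesis by simp
qed

text \<open>
  A semilinear functional is determined by its values on a basis, and those on \<open>I\<close> are prescribed. The
  twist \<open>\<sigma>\<close> allows for the diagonals \<open>x \<mapsto> f x x\<close> of symmetric forms in characteristic 2, which
  are additive but scale by \<open>c * c\<close>.
\<close>

lemma card_semilinear:
  fixes A :: "('v \<Rightarrow> 'k) set"
  assumes fin: "finite (UNIV :: 'v set)" and ind: "independent I"
    and add: "\<And>\<phi> x y. \<phi> \<in> A \<Longrightarrow> \<phi> (x + y) = \<phi> x + \<phi> y"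
    and scl: "\<And>\<phi> c x. \<phi> \<in> A \<Longrightarrow> \<phi> (scale c x) = \<sigma> c * \<phi> x"
    and van: "\<And>\<phi> x. \<phi> \<in> A \<Longrightarrow> x \<in> I \<Longrightarrow> \<phi> x = 0"
  shows "card A * CARD('k) ^ card I \<le> card (UNIV :: 'v set)"
proof -
  let ?B = "extend_basis I"
  have B: "I \<subseteq> ?B" "independent ?B" "span ?B = UNIV"
    using ind extend_basis_superset independent_extend_basis by simp_all
  have finB: "finite ?B" "finite I" using fin finite_subset[OF subset_UNIV] by blast+
  have cV: "card (UNIV :: 'v set) = CARD('k) ^ card ?B" using card_span[OF B(2) finB(1)] B(3) by simp
  let ?F = "(?B - I) \<rightarrow>\<^sub>E (UNIV :: 'k set)"
  have "inj_on (\<lambda>\<phi>. restrict \<phi> (?B - I)) A"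
  proof (rule inj_onI)
    fix \<phi> \<psi> assume p: "\<phi> \<in> A" "\<psi> \<in> A" "restrict \<phi> (?B - I) = restrict \<psi> (?B - I)"
    have eqB: "\<phi> b = \<psi> b" if "b \<in> ?B" for b
      using that p van by (metis DiffI restrict_apply')
    have "\<chi> 0 = 0" if "\<chi> \<in> A" for \<chi>
      using add[OF that, of 0 0] by (simp only: add_0_left add_cancel_right_right)
    then have z: "\<phi> 0 = 0" "\<psi> 0 = 0" using p by blast+
    have "\<phi> x = \<psi> x" for x
    proof -
      have "x \<in> span ?B" using B by simp
      then show ?thesis
        by (induction rule: span_induct) (auto simp: subspace_def eqB z add p scl)
    qed
    then show "\<phi> = \<psi>" by blast
  qed
  moreover have "(\<lambda>\<phi>. restrict \<phi> (?B - I)) ` A \<subseteq> ?F" by (rule image_subsetI) (simp only: restrict_PiE_iff UNIV_I ball_triv simp_thms)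
  moreover have "finite ?F" using finB by (intro finite_PiE) auto
  ultimately have "card A \<le> card ?F" by (metis card_inj_on_le)
  also have "\<dots> = CARD('k) ^ (card ?B - card I)"
    using finB B(1) by (simp add: card_funcsetE card_Diff_subset)
  finally have "card A * CARD('k) ^ card I \<le> CARD('k) ^ (card ?B - card I) * CARD('k) ^ card I" by simp
  also have "\<dots> = card (UNIV :: 'v set)"
    using cV card_mono[OF finB(1) B(1)] by (simp flip: power_add)
  finally show ?thesis .
qed

end

lemma finite_field_space_form_scale:
  "finite_field_space (form_scale :: 'k::{field, finite} \<Rightarrow> ('v \<Rightarrow> 'v \<Rightarrow> 'k) \<Rightarrow> _)"
  by unfold_locales

section \<open>Finite fields of characteristic two\<close>

lemma add_eq_0_iff_char_two:
  fixes a b :: "'k::field"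
  assumes "(1::'k) + 1 = 0"
  shows "a + b = 0 \<longleftrightarrow> b = a"
proof -
  have "a + a = a * (1 + 1)" by (simp only: distrib_left mult_1_right)
  then have "a + a = 0" by (simp only: assms mult_zero_right)
  then have "- a = a" by (rule minus_unique)
  then show ?thesis using add_eq_0_iff[of a b] by (simp only:)
qed

lemma square_eq_iff_char_two:
  fixes a b :: "'k::field"
  assumes "(1::'k) + 1 = 0"
  shows "a * a = b * b \<longleftrightarrow> a = b"
  using square_eq_iff[of a b] add_eq_0_iff_char_two[OF assms, of b a]
    eq_neg_iff_add_eq_0[of a b] by (auto simp: add.commute)

lemma surj_square_char_two:
  assumes "(1::'k::{field, finite}) + 1 = 0"
  shows "surj (\<lambda>x::'k. x * x)"
proof (rule finite_UNIV_inj_surj)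
  show "inj (\<lambda>x::'k. x * x)" by (rule injI) (simp only: square_eq_iff_char_two[OF assms])
qed simp

text \<open>
  The map \<open>x \<mapsto> x * x + x\<close> takes the value 0 at both 0 and 1, so on a finite field it is not
  surjective either.
\<close>

lemma exists_Artin_Schreier_irreducible:
  assumes two: "(1::'k::{field, finite}) + 1 = 0"
  obtains c :: "'k::{field, finite}" where "\<And>x. x * x + x + c \<noteq> 0"
proof -
  let ?h = "\<lambda>x::'k. x * x + x"
  have "?h 0 = ?h 1" using two by (simp only: mult_zero_left mult_1_left add_0_left)
  then have "\<not> inj ?h" using injD[of ?h 0 1] zero_neq_one by blast
  then have "\<not> surj ?h" using finite_UNIV_surj_inj[of ?h] finite by blast
  then obtain d :: 'k where d: "d \<noteq> ?h x" for x by (auto simp: surj_def)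
  have "x * x + x + (- d) \<noteq> 0" for x using d[of x] by (simp only: add_uminus_conv_diff right_minus_eq) simp
  then show ?thesis by (rule that)
qed

text \<open>
  Translation by 1 permutes the field, so adding up all elements shows that the order of the field
  vanishes in it.
\<close>

lemma char_two_of_card_power_two:
  assumes "card (UNIV :: 'k::{field, finite} set) = 2 ^ m"
  shows "(1::'k) + 1 = 0"
proof -
  have "(\<Sum>x\<in>UNIV. x) = (\<Sum>x\<in>UNIV. x + (1::'k))"
    by (rule sum.reindex_bij_witness[where i = "\<lambda>x. x + 1" and j = "\<lambda>x. x - 1"]) auto
  then have "of_nat (2 ^ m) = (0::'k)" by (simp add: sum.distrib assms)
  then show ?thesis by (simp add: one_add_one)
qed

section \<open>Symmetric bilinear forms on a subspace\<close>

context finite_field_space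
begin

lemma Symm_bilinear:
  assumes "f \<in> Symm scale"
  shows Symm_add_right: "f z (x + y) = f z x + f z y"
    and Symm_scale_right: "f z (scale c x) = c * f z x"
    and Symm_add_left: "f (x + y) z = f x z + f y z"
    and Symm_scale_left: "f (scale c x) z = c * f x z"
    and Symm_commute: "f x y = f y x"
proof -
  have sym: "f x y = f y x" for x y using assms by (simp add: Symm_def)
  have lin: "Vector_Spaces.linear scale (*) (f u)" for u
    using assms by (simp add: Symm_def bilinear_form_def)
  show add: "f z (x + y) = f z x + f z y" for x y z
    using module_hom.add[OF lin[unfolded module_hom_eq_linear[symmetric]]] .
  show scl: "f z (scale c x) = c * f z x" for c x z
    using module_hom.scale[OF lin[unfolded module_hom_eq_linear[symmetric]]] .
  show "f (x + y) z = f x z + f y z" using add sym by metis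
  show "f (scale c x) z = c * f x z" using scl sym by metis
  show "f x y = f y x" by (rule sym)
qed

lemma Symm_zero_diff:
  assumes "f \<in> Symm scale"
  shows Symm_zero_right: "f z 0 = 0" and Symm_zero_left: "f 0 z = 0"
    and Symm_diff_right: "f z (x - y) = f z x - f z y"
    and Symm_diff_left: "f (x - y) z = f x z - f y z"
proof -
  show z: "f z 0 = 0" for z using Symm_add_right[OF assms, of z 0 0] by (simp only: add_0_left add_cancel_right_right)
  show "f 0 z = 0" using z Symm_commute[OF assms] by metis
  show d: "f z (x - y) = f z x - f z y" for x y z
    using Symm_add_right[OF assms, of z "x - y" y] by simp
  show "f (x - y) z = f x z - f y z" using d Symm_commute[OF assms] by metis
qed

lemmas Symm_simps = Symm_add_right Symm_scale_right Symm_add_left Symm_scale_left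
  Symm_zero_diff

definition rad_on :: "'v set \<Rightarrow> ('v \<Rightarrow> 'v \<Rightarrow> 'k) \<Rightarrow> 'v set"
  where "rad_on W f = {x \<in> W. \<forall>y\<in>W. f x y = 0}"

lemma rad_on_UNIV: "rad_on UNIV f = form_radical f"
  by (simp add: rad_on_def form_radical_def)

lemma subspace_perp:
  assumes f: "f \<in> Symm scale" and W: "subspace W"
  shows "subspace {w \<in> W. f x w = 0}"
  using W by (auto simp: subspace_def Symm_simps[OF f])

lemma card_perp:
  assumes f: "f \<in> Symm scale" and W: "subspace W" "finite W" and w: "w \<in> W" "f x w \<noteq> 0"
  shows "card W = CARD('k) * card {w \<in> W. f x w = 0}"
  by (rule card_level_surj[where \<sigma> = "\<lambda>c. c" and \<phi> = "f x" and w = w])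
    (use assms in \<open>auto simp: Symm_simps[OF f] surj_def\<close>)

text \<open>
  Splitting off a hyperbolic plane leaves the radical unchanged and divides the order of the space by
  the square of the order of the field. The rank of \<open>f\<close> on \<open>W\<close> is expressed by the index of the radical,
  which makes the induction independent of dimensions.
\<close>

lemma alternating_even_rank:
  assumes "finite W" and f: "f \<in> Symm scale" and "subspace W" and "\<And>x. x \<in> W \<Longrightarrow> f x x = 0"
  shows "\<exists>j. even j \<and> card W = CARD('k) ^ j * card (rad_on W f)"
  using assms(1,3,4)
proof (induction "card W" arbitrary: W rule: less_induct)
  case less
  note W = less.prems
  show ?case
  proof (cases "rad_on W f = W")
    case True
    then show ?thesis by (intro exI[of _ 0]) simp
  next
    case False
    then obtain x y' where x: "x \<in> W" and y': "y' \<in> W" "f x y' \<noteq> 0" by (auto simp: rad_on_def)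
    define y where "y = scale (inverse (f x y')) y'"
    have y: "y \<in> W" "f x y = 1"
      using y' W(2) by (simp_all add: y_def Symm_simps[OF f] subspace_scale)
    have yx: "f y x = 1" using y(2) Symm_commute[OF f] by metis
    define W1 where "W1 = {w \<in> W. f x w = 0}"
    define W' where "W' = {w \<in> W1. f y w = 0}"
    have W1: "subspace W1" "finite W1" "card W = CARD('k) * card W1"
      using subspace_perp[OF f W(2)] card_perp[OF f W(2,1) y(1)] y(2) W(1) by (auto simp: W1_def)
    have xW1: "x \<in> W1" using x W(3) by (simp add: W1_def)
    have W': "subspace W'" "finite W'" "card W1 = CARD('k) * card W'"
      using subspace_perp[OF f W1(1)] card_perp[OF f W1(1,2) xW1] yx W1(2) by (auto simp: W'_def)
    have cW: "card W = CARD('k) ^ 2 * card W'" using W1(3) W'(3) by (simp add: power2_eq_square)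
    have "card W' > 0" using W' subspace_0 by (auto simp: card_gt_0_iff)
    then have lt: "card W' < card W" using cW q_ge_2 by (simp add: power2_eq_square) 
        (metis One_nat_def Suc_1 Suc_le_lessD less_1_mult)
    have rad: "rad_on W' f = rad_on W f"
    proof
      show "rad_on W f \<subseteq> rad_on W' f"
        using x y(1) Symm_commute[OF f] by (auto simp: rad_on_def W'_def W1_def)
      \<comment> \<open>an element of the radical of \<open>W'\<close> is orthogonal to \<open>x\<close> and \<open>y\<close> as well, hence to all of \<open>W\<close>\<close>
      show "rad_on W' f \<subseteq> rad_on W f"
      proof
        fix r assume r: "r \<in> rad_on W' f"
        then have r0: "r \<in> W" "f r x = 0" "f r y = 0"
          using Symm_commute[OF f] by (auto simp: rad_on_def W'_def W1_def)
        have "f r w = 0" if w: "w \<in> W" for w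
        proof -
          define w' where "w' = w - scale (f w y) x - scale (f x w) y"
          have "w' \<in> W" using w x y(1) W(2) by (simp add: w'_def subspace_diff subspace_scale)
          moreover have "f x w' = 0" using W(3)[OF x] y(2) by (simp add: w'_def Symm_simps[OF f])
          moreover have "f y w' = 0" using W(3)[OF y(1)] yx Symm_commute[OF f, of y w]
            by (simp add: w'_def Symm_simps[OF f])
          ultimately have "w' \<in> W'" by (simp add: W'_def W1_def)
          then have "f r w' = 0" using r by (simp add: rad_on_def)
          then show ?thesis using r0 by (simp add: w'_def Symm_simps[OF f])
        qed
        then show "r \<in> rad_on W f" using r0 by (simp add: rad_on_def)
      qed
    qed
    have "\<exists>j. even j \<and> card W' = CARD('k) ^ j * card (rad_on W' f)"
      by (rule less.hyps[OF lt W'(2,1)]) (use W(3) in \<open>auto simp: W'_def W1_def\<close>)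
    then obtain j where "even j" "card W' = CARD('k) ^ j * card (rad_on W' f)" by blast
    then show ?thesis using cW rad
      by (intro exI[of _ "j + 2"]) (simp add: power_add power2_eq_square)
  qed
qed

section \<open>Zeros of the elliptic value of a form\<close>

text \<open>
  When \<open>X\<^sup>2 + X + c\<close> has no root, this is the value at \<open>(x, y)\<close> of the quadratic form obtained from \<open>f\<close>
  by tensoring with the norm form of the quadratic field extension. Over that extension it would be a
  Hermitian form, which is why its zeros see nothing of \<open>f\<close> but its rank.
\<close>

definition elliptic_value :: "'k \<Rightarrow> ('v \<Rightarrow> 'v \<Rightarrow> 'k) \<Rightarrow> 'v \<Rightarrow> 'v \<Rightarrow> 'k"
  where "elliptic_value c f x y = f x x + f x y + c * f y y"

definition elliptic_fibre :: "'k \<Rightarrow> 'v set \<Rightarrow> ('v \<Rightarrow> 'v \<Rightarrow> 'k) \<Rightarrow> 'k \<Rightarrow> ('v \<times> 'v) set"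
  where "elliptic_fibre c W f a = {p \<in> W \<times> W. elliptic_value c f (fst p) (snd p) = a}"

text \<open>
  On an alternating form the quadratic terms disappear and the zeros are the orthogonal pairs: a vector in
  the radical is orthogonal to all of \<open>W\<close>, any other vector to a hyperplane.
\<close>

lemma card_elliptic_zeros_alternating:
  assumes fin: "finite W" and f: "f \<in> Symm scale" and W: "subspace W"
    and alt: "\<And>x. x \<in> W \<Longrightarrow> f x x = 0"
  shows "int CARD('k) * int (card (elliptic_fibre c W f 0)) =
    int (card W) ^ 2 + (int CARD('k) - 1) * int (card W) * int (card (rad_on W f))"
proof -
  let ?q = "int CARD('k)" and ?w = "int (card W)" and ?R = "rad_on W f"
  have "elliptic_fibre c W f 0 = (SIGMA x:W. {y \<in> W. f x y = 0})"
    by (auto simp: elliptic_fibre_def elliptic_value_def alt)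
  then have "int (card (elliptic_fibre c W f 0)) = (\<Sum>x\<in>W. int (card {y \<in> W. f x y = 0}))"
    using fin by simp
  then have "?q * int (card (elliptic_fibre c W f 0)) = (\<Sum>x\<in>W. ?q * int (card {y \<in> W. f x y = 0}))"
    by (simp add: sum_distrib_left)
  also have "\<dots> = (\<Sum>x\<in>W. ?w + (if x \<in> ?R then (?q - 1) * ?w else 0))"
  proof (rule sum.cong)
    fix x assume x: "x \<in> W"
    show "?q * int (card {y \<in> W. f x y = 0}) = ?w + (if x \<in> ?R then (?q - 1) * ?w else 0)"
    proof (cases "x \<in> ?R")
      case True
      then have "{y \<in> W. f x y = 0} = W" by (auto simp: rad_on_def)
      then show ?thesis using True by (simp add: algebra_simps)
    next
      case False
      then obtain w where "w \<in> W" "f x w \<noteq> 0" using x by (auto simp: rad_on_def)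
      then have "card W = CARD('k) * card {y \<in> W. f x y = 0}" by (rule card_perp[OF f W fin])
      then show ?thesis using False by simp
    qed
  qed simp
  also have "\<dots> = ?w * ?w + int (card ?R) * ((?q - 1) * ?w)"
  proof -
    have "W \<inter> ?R = ?R" by (auto simp: rad_on_def)
    then show ?thesis using fin by (simp add: sum.distrib flip: sum.inter_restrict)
  qed
  finally show ?thesis by (simp add: power2_eq_square algebra_simps)
qed

text \<open>
  If \<open>f\<close> is not alternating on \<open>W\<close>, then \<open>W\<close> is the orthogonal sum of a line spanned by some \<open>x0\<close> with
  \<open>f x0 x0 = 1\<close> and a hyperplane \<open>W'\<close>. On the line the elliptic value is the anisotropic form
  \<open>s * s + s * t + c * (t * t)\<close>, so with \<open>q\<close> the order of the field one coordinate pair asks for a zero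
  on \<open>W'\<close> and \<open>q\<^sup>2 - 1\<close> pairs ask for a non-zero value. All non-zero values are taken equally often, since
  every field element is a square. The resulting recursion flips the sign of the deviation from the
  average while the rank drops by one.
\<close>

lemma card_elliptic_zeros:
  assumes two: "(1::'k) + 1 = 0" and c: "\<And>x. x * x + x + c \<noteq> 0"
    and "finite W" and f: "f \<in> Symm scale" and "subspace W"
  shows "\<exists>j. card W = CARD('k) ^ j * card (rad_on W f) \<and>
    int CARD('k) * int (card (elliptic_fibre c W f 0)) =
      int (card W) ^ 2 + (- 1) ^ j * (int CARD('k) - 1) * int (card W) * int (card (rad_on W f))"
  using assms(3,5)
proof (induction "card W" arbitrary: W rule: less_induct)
  case less
  note W = less.prems
  let ?q = "CARD('k)" and ?Q = "elliptic_value c f"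
  show ?case
  proof (cases "\<forall>x\<in>W. f x x = 0")
    case True
    then obtain j where "even j" "card W = ?q ^ j * card (rad_on W f)"
      using alternating_even_rank[OF W(1) f W(2)] by blast
    then show ?thesis
      using card_elliptic_zeros_alternating[OF W(1) f W(2), of c] True
      by (intro exI[of _ j]) simp
  next
    case False
    then obtain x1 where x1: "x1 \<in> W" "f x1 x1 \<noteq> 0" by blast
    obtain s where s: "s * s = inverse (f x1 x1)"
      using surjD[OF surj_square_char_two[OF two]] by metis
    define x0 where "x0 = scale s x1"
    have x0: "x0 \<in> W" "f x0 x0 = 1"
      using x1 W(2) s by (simp_all add: x0_def subspace_scale Symm_simps[OF f] field_simps)
    define W' where "W' = {w \<in> W. f x0 w = 0}"
    have W': "subspace W'" "finite W'" "card W = ?q * card W'"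
      using subspace_perp[OF f W(2)] card_perp[OF f W(2,1) x0(1)] x0(2) W(1) by (auto simp: W'_def)
    have W'sub: "W' \<subseteq> W" by (auto simp: W'_def)
    have "card W' > 0" using W' subspace_0 by (auto simp: card_gt_0_iff)
    then have lt: "card W' < card W" using W'(3) q_ge_2 by simp
    have rad: "rad_on W' f = rad_on W f"
    proof
      show "rad_on W f \<subseteq> rad_on W' f"
        using x0(1) Symm_commute[OF f] by (auto simp: rad_on_def W'_def)
      show "rad_on W' f \<subseteq> rad_on W f"
      proof
        fix r assume r: "r \<in> rad_on W' f"
        then have r0: "r \<in> W" "f r x0 = 0" using Symm_commute[OF f] by (auto simp: rad_on_def W'_def)
        have "f r w = 0" if w: "w \<in> W" for w
        proof -
          have "w - scale (f x0 w) x0 \<in> W'"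
            using w x0 W(2) by (simp add: W'_def subspace_diff subspace_scale Symm_simps[OF f])
          then have "f r (w - scale (f x0 w) x0) = 0" using r by (simp add: rad_on_def)
          then show ?thesis using r0 by (simp add: Symm_simps[OF f])
        qed
        then show "r \<in> rad_on W f" using r0 by (simp add: rad_on_def)
      qed
    qed
    obtain j where j: "card W' = ?q ^ j * card (rad_on W f)"
      "int ?q * int (card (elliptic_fibre c W' f 0)) =
        int (card W') ^ 2 + (- 1) ^ j * (int ?q - 1) * int (card W') * int (card (rad_on W f))"
      using less.hyps[OF lt W'(2,1)] unfolding rad by blast
    define T where "T = elliptic_fibre c W' f"
    have finT: "finite (T a)" for a using W'(2) by (simp add: T_def elliptic_fibre_def)
    define N where "N = (\<lambda>(s, t). s * s + s * t + c * (t * t))"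
    \<comment> \<open>\<open>N\<close> is anisotropic by the choice of \<open>c\<close>\<close>
    have N0: "N p = 0 \<longleftrightarrow> p = (0, 0)" for p
    proof (cases p)
      case (Pair s t)
      show ?thesis
      proof (cases "t = 0")
        case False
        have "s * s + s * t + c * (t * t) = (t * t) * ((s / t) * (s / t) + s / t + c)"
          using False by (simp add: field_simps)
        then show ?thesis using False c[of "s / t"] by (simp add: N_def Pair)
      qed (simp add: N_def Pair)
    qed
    note plus0 = add_eq_0_iff_char_two[OF two]
    have two_eq_0: "(2::'k) = 0" using two by (simp only: one_add_one)
    have Qsplit: "?Q (scale s x0 + w) (scale t x0 + w') = N (s, t) + ?Q w w'"
      if "w \<in> W'" "w' \<in> W'" for s t w w'
    proof -
      have "f x0 w = 0" "f x0 w' = 0" "f w x0 = 0" "f w' x0 = 0"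
        using that Symm_commute[OF f, of _ x0] by (auto simp: W'_def)
      then show ?thesis
        by (simp add: elliptic_value_def N_def Symm_simps[OF f] x0(2) algebra_simps)
    qed
    have T1: "card (T a) = card (T 1)" if "a \<noteq> 0" for a
    proof -
      obtain d where d: "d * d = a" using surjD[OF surj_square_char_two[OF two]] by metis
      have d0: "d \<noteq> 0" using d that by auto
      have Qs: "?Q (scale e x) (scale e y) = e * e * ?Q x y" for e x y
        by (simp add: elliptic_value_def Symm_simps[OF f] algebra_simps)
      have "bij_betw (\<lambda>(x, y). (scale d x, scale d y)) (T 1) (T a)"
        by (rule bij_betw_byWitness[where f' = "\<lambda>(x, y). (scale (inverse d) x, scale (inverse d) y)"])
          (use d0 d W'(1) in \<open>auto simp: T_def elliptic_fibre_def Qs subspace_scale field_simps\<close>)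
      then show ?thesis by (metis bij_betw_same_card)
    qed
    have all: "int (card W') ^ 2 = int (card (T 0)) + (int ?q - 1) * int (card (T 1))"
    proof -
      have "card (W' \<times> W') = (\<Sum>p\<in>W' \<times> W'. card {a \<in> UNIV. ?Q (fst p) (snd p) = a})" by simp
      also have "\<dots> = (\<Sum>a\<in>UNIV. card {p \<in> W' \<times> W'. ?Q (fst p) (snd p) = a})"
        by (rule sum_card_swap) (use W'(2) in auto)
      also have "\<dots> = (\<Sum>a\<in>UNIV. card (T a))" by (simp add: T_def elliptic_fibre_def)
      also have "\<dots> = card (T 0) + (\<Sum>a\<in>UNIV - {0}. card (T a))" by (subst sum.remove[of _ 0]) auto
      also have "(\<Sum>a\<in>UNIV - {0}. card (T a)) = (\<Sum>a\<in>UNIV - {0::'k}. card (T 1))"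
        by (intro sum.cong refl T1) simp
      also have "\<dots> = (?q - 1) * card (T 1)" by simp
      finally have "int (card (W' \<times> W')) = int (card (T 0) + (?q - 1) * card (T 1))" by (rule arg_cong)
      then show ?thesis using q_ge_2
        by (simp add: card_cartesian_product power2_eq_square of_nat_diff)
    qed
    have Z: "int (card (elliptic_fibre c W f 0)) = int (card (T 0)) + (int ?q ^ 2 - 1) * int (card (T 1))"
    proof -
      \<comment> \<open>coordinates with respect to the splitting of \<open>W\<close> into a line and \<open>W'\<close>\<close>
      let ?to = "\<lambda>((s, t), (w, w')). (scale s x0 + w, scale t x0 + w')"
      let ?from = "\<lambda>(x, y). ((f x0 x, f x0 y), (x - scale (f x0 x) x0, y - scale (f x0 y) x0))"
      have proj: "x - scale (f x0 x) x0 \<in> W'" if "x \<in> W" for x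
        using that x0 W(2) by (simp add: W'_def subspace_diff subspace_scale Symm_simps[OF f])
      have emb: "scale s x0 + w \<in> W" if "w \<in> W'" for s w
        using that x0 W(2) by (simp add: W'_def subspace_add subspace_scale)
      have ev: "f x0 (scale s x0 + w) = s" if "w \<in> W'" for s w
        using that x0 by (simp add: W'_def Symm_simps[OF f])
      have Qx: "?Q x y = N (f x0 x, f x0 y) + ?Q (x - scale (f x0 x) x0) (y - scale (f x0 y) x0)"
        if "x \<in> W" "y \<in> W" for x y
        using Qsplit[OF proj[OF that(1)] proj[OF that(2)], of "f x0 x" "f x0 y"] by simp
      have "bij_betw ?to (SIGMA p:UNIV. T (N p)) (elliptic_fibre c W f 0)"
      proof (rule bij_betw_byWitness[where f' = ?from])
        show "\<forall>a\<in>SIGMA p:UNIV. T (N p). ?from (?to a) = a"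
          by (auto simp: T_def elliptic_fibre_def ev)
        show "\<forall>a'\<in>elliptic_fibre c W f 0. ?to (?from a') = a'" by auto
        show "?to ` (SIGMA p:UNIV. T (N p)) \<subseteq> elliptic_fibre c W f 0"
          by (auto simp: T_def elliptic_fibre_def Qsplit emb two_eq_0)
        show "?from ` elliptic_fibre c W f 0 \<subseteq> (SIGMA p:UNIV. T (N p))"
          using Qx by (fastforce simp: T_def elliptic_fibre_def proj plus0)
      qed
      then have "card (elliptic_fibre c W f 0) = card (SIGMA p:UNIV. T (N p))"
        by (metis bij_betw_same_card)
      also have "\<dots> = (\<Sum>p\<in>UNIV. card (T (N p)))" using finT by simp
      also have "\<dots> = card (T (N (0, 0))) + (\<Sum>p\<in>UNIV - {(0, 0)}. card (T (N p)))"
        by (subst sum.remove[of _ "(0, 0)"]) auto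
      also have "(\<Sum>p\<in>UNIV - {(0, 0)}. card (T (N p))) = (\<Sum>p\<in>UNIV - {(0, 0) :: 'k \<times> 'k}. card (T 1))"
        using N0 by (intro sum.cong refl T1) auto
      also have "\<dots> = (?q ^ 2 - 1) * card (T 1)" by (simp add: power2_eq_square)
      finally have "card (elliptic_fibre c W f 0) = card (T 0) + (?q ^ 2 - 1) * card (T 1)"
        using N0[of "(0, 0)"] by simp
      moreover have "int (?q ^ 2 - 1) = int ?q ^ 2 - 1" using q_ge_2 by (simp add: of_nat_diff)
      ultimately show ?thesis by simp
    qed
    have "int ?q * int (card (elliptic_fibre c W f 0)) =
      int (card W) ^ 2 + (- 1) ^ Suc j * (int ?q - 1) * int (card W) * int (card (rad_on W f))"
    proof -
      have "int (card (elliptic_fibre c W f 0)) = int (card (T 0)) + (int ?q + 1) * ((int ?q - 1) * int (card (T 1)))"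
        unfolding Z by (simp add: power2_eq_square algebra_simps)
      also have "(int ?q - 1) * int (card (T 1)) = int (card W') ^ 2 - int (card (T 0))" using all by simp
      also have "int (card (T 0)) + (int ?q + 1) * (int (card W') ^ 2 - int (card (T 0))) =
        (int ?q + 1) * int (card W') ^ 2 - int ?q * int (card (T 0))" by (simp add: algebra_simps)
      also have "int ?q * int (card (T 0)) =
        int (card W') ^ 2 + (- 1) ^ j * (int ?q - 1) * int (card W') * int (card (rad_on W f))"
        using j(2) by (simp only: T_def)
      finally have Z': "int (card (elliptic_fibre c W f 0)) = (int ?q + 1) * int (card W') ^ 2 -
        (int (card W') ^ 2 + (- 1) ^ j * (int ?q - 1) * int (card W') * int (card (rad_on W f)))" .
      show ?thesis unfolding W'(3) Z' by (simp add: algebra_simps power2_eq_square)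
    qed
    moreover have "card W = ?q ^ Suc j * card (rad_on W f)" using W'(3) j(1) by simp
    ultimately show ?thesis by blast
  qed
qed

end

section \<open>Rank and spaces of forms\<close>

context finite_field_space
begin

lemma subspace_radical:
  assumes "f \<in> Symm scale"
  shows "subspace (form_radical f)"
  by (auto simp: subspace_def form_radical_def Symm_simps[OF assms])

lemma form_radical_alt_def: "form_radical f = {u. f u = 0}"
  by (auto simp: form_radical_def fun_eq_iff)

lemma card_radical:
  assumes fin: "finite (UNIV :: 'v set)" and f: "f \<in> Symm scale"
  shows "form_rank scale f \<le> dim (UNIV :: 'v set)"
    and "card (form_radical f) = CARD('k) ^ (dim (UNIV :: 'v set) - form_rank scale f)"
proof -
  show "form_rank scale f \<le> dim (UNIV :: 'v set)" by (simp add: form_rank_def)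
  have c: "card (form_radical f) = CARD('k) ^ dim (form_radical f)"
    using card_subspace[OF subspace_radical[OF f]] fin finite_subset[OF subset_UNIV] by blast
  have "card (UNIV :: 'v set) = CARD('k) ^ dim (UNIV :: 'v set)"
    using card_subspace[OF subspace_UNIV] fin by blast
  then have "CARD('k) ^ dim (form_radical f) \<le> CARD('k) ^ dim (UNIV :: 'v set)"
    using c card_mono[OF fin, of "form_radical f"] by simp
  then have "dim (form_radical f) \<le> dim (UNIV :: 'v set)"
    using q_ge_2 by (simp add: power_le_imp_le_exp)
  then show "card (form_radical f) = CARD('k) ^ (dim (UNIV :: 'v set) - form_rank scale f)"
    using c by (simp add: form_rank_def)
qed

text \<open>
  The index of the radical determines the rank; this transfers the inductive counts above, which are in
  terms of an exponent \<open>j\<close>, to \<open>form_rank\<close>.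
\<close>

lemma rank_eqI:
  assumes fin: "finite (UNIV :: 'v set)" and f: "f \<in> Symm scale"
    and j: "card (UNIV :: 'v set) = CARD('k) ^ j * card (form_radical f)"
  shows "form_rank scale f = j"
proof -
  let ?n = "dim (UNIV :: 'v set)" and ?r = "form_rank scale f"
  have "card (UNIV :: 'v set) = CARD('k) ^ ?n"
    using card_subspace[OF subspace_UNIV] fin by blast
  then have "CARD('k) ^ ?n = CARD('k) ^ (j + (?n - ?r))"
    using j card_radical(2)[OF fin f] unfolding power_add by presburger
  then have "?n = j + (?n - ?r)" using q_ge_2 by (simp add: power_inject_exp)
  then show ?thesis using card_radical(1)[OF fin f] by simp
qed

lemma even_rank_alternating:
  assumes fin: "finite (UNIV :: 'v set)" and f: "f \<in> Symm scale" and "\<And>x. f x x = 0"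
  shows "even (form_rank scale f)"
proof -
  obtain j where "even j" "card (UNIV :: 'v set) = CARD('k) ^ j * card (form_radical f)"
    using alternating_even_rank[OF fin f subspace_UNIV] assms(3) by (auto simp: rad_on_UNIV)
  then show ?thesis using rank_eqI[OF fin f] by blast
qed

lemma card_elliptic_zeros_by_rank:
  assumes "(1::'k) + 1 = 0" and "\<And>x. x * x + x + c \<noteq> 0"
    and fin: "finite (UNIV :: 'v set)" and f: "f \<in> Symm scale"
  shows "int CARD('k) * int (card (elliptic_fibre c UNIV f 0)) = int (card (UNIV :: 'v set)) ^ 2 +
    (- 1) ^ form_rank scale f * (int CARD('k) - 1) * int (card (UNIV :: 'v set)) * int (card (form_radical f))"
  using card_elliptic_zeros[OF assms(1,2) fin f subspace_UNIV] rank_eqI[OF fin f]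
  by (auto simp: rad_on_UNIV)

text \<open>
  Rank and nullity of \<open>f \<mapsto> f u\<close> on \<open>A\<close>, whose image consists of linear functionals vanishing on \<open>I\<close>.
\<close>

lemma card_le_card_forms_killing:
  fixes A :: "('v \<Rightarrow> 'v \<Rightarrow> 'k) set"
  assumes fin: "finite (UNIV :: 'v set)" and A: "A \<subseteq> Symm scale" "form.subspace A" "finite A"
    and I: "independent I" and van: "\<And>f x. f \<in> A \<Longrightarrow> x \<in> I \<Longrightarrow> f u x = 0"
  shows "card A * CARD('k) ^ card I \<le> card (UNIV :: 'v set) * card {f \<in> A. f u = 0}"
proof -
  have "card A = card {f \<in> A. f u = 0} * card ((\<lambda>f. f u) ` A)"
    by (rule card_eq_card_kernel_times_card_image)
      (use A in \<open>auto simp: form.subspace_add form.subspace_diff\<close>)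
  moreover have "card ((\<lambda>f. f u) ` A) * CARD('k) ^ card I \<le> card (UNIV :: 'v set)"
    by (rule card_semilinear[OF fin I, where \<sigma> = "\<lambda>c. c"])
      (use A van in \<open>auto simp: Symm_add_right Symm_scale_right\<close>)
  ultimately show ?thesis by (simp only: mult.assoc mult.commute[of "card UNIV"] mult_le_mono2)
qed

text \<open>
  Rank and nullity of \<open>f \<mapsto> (\<lambda>x. f x x)\<close> on \<open>A\<close>. In characteristic 2 these diagonals are additive, hence
  semilinear with respect to squaring.
\<close>

lemma card_le_card_alternating_part:
  fixes A :: "('v \<Rightarrow> 'v \<Rightarrow> 'k) set"
  assumes fin: "finite (UNIV :: 'v set)" and A: "A \<subseteq> Symm scale" "form.subspace A" "finite A"
    and two: "(1::'k) + 1 = 0"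
    and I: "independent I" and van: "\<And>f x. f \<in> A \<Longrightarrow> x \<in> I \<Longrightarrow> f x x = 0"
  shows "card A * CARD('k) ^ card I \<le> card (UNIV :: 'v set) * card (alternating_part A)"
proof -
  have alt: "alternating_part A = {f \<in> A. (\<lambda>x. f x x) = 0}"
    by (auto simp: alternating_part_def fun_eq_iff)
  have "card A = card {f \<in> A. (\<lambda>x. f x x) = 0} * card ((\<lambda>f x. f x x) ` A)"
    by (rule card_eq_card_kernel_times_card_image)
      (use A in \<open>auto simp: form.subspace_add form.subspace_diff\<close>)
  moreover have "card ((\<lambda>f x. f x x) ` A) * CARD('k) ^ card I \<le> card (UNIV :: 'v set)"
  proof (rule card_semilinear[OF fin I, where \<sigma> = "\<lambda>c. c * c"])
    fix \<phi> x y assume "\<phi> \<in> (\<lambda>f x. f x x) ` A"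
    then obtain f where f: "f \<in> A" "\<phi> = (\<lambda>x. f x x)" by blast
    have "f x y + f x y = 0" by (simp only: add_eq_0_iff_char_two[OF two])
    moreover have "f (x + y) (x + y) = f x x + (f x y + f x y) + f y y"
      using Symm_commute[of f y x] A(1) f(1) by (auto simp: Symm_add_left Symm_add_right subset_iff algebra_simps)
    ultimately show "\<phi> (x + y) = \<phi> x + \<phi> y" by (simp only: f(2) add_0_right)
  qed (use A van in \<open>auto simp: Symm_scale_left Symm_scale_right\<close>)
  ultimately show ?thesis unfolding alt
    by (simp only: mult.assoc mult.commute[of "card UNIV"] mult_le_mono2)
qed

lemma sum_card_forms_killing:
  assumes fin: "finite (UNIV :: 'v set)" and "finite A"
  shows "(\<Sum>u\<in>UNIV. card {f \<in> A. f u = 0}) = (\<Sum>f\<in>A. card (form_radical (f :: 'v \<Rightarrow> 'v \<Rightarrow> 'k)))"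
  using sum_card_swap[OF assms, of "\<lambda>u f. f u = 0"] by (simp add: form_radical_alt_def)

lemma form_subspace_killing:
  fixes A :: "('v \<Rightarrow> 'v \<Rightarrow> 'k) set"
  shows "form.subspace A \<Longrightarrow> form.subspace {f \<in> A. f u = 0}"
  by (auto simp: form.subspace_def form_scale_def fun_eq_iff)

lemma form_subspace_alternating_part:
  fixes A :: "('v \<Rightarrow> 'v \<Rightarrow> 'k) set"
  shows "form.subspace A \<Longrightarrow> form.subspace (alternating_part A)"
  by (auto simp: form.subspace_def form_scale_def alternating_part_def)

end

section \<open>Spaces of forms of rank at least n - 2\<close>

locale minimum_rank_space = finite_field_space scale
  for scale :: "'k::{field, finite} \<Rightarrow> 'v::ab_group_add \<Rightarrow> 'v" +
  fixes n :: nat and M :: "('v \<Rightarrow> 'v \<Rightarrow> 'k) set"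
  assumes char_two: "(1::'k) + 1 = 0"
    and dim_V: "dim (UNIV :: 'v set) = n" and n_ge_3: "n \<ge> 3" and odd_n: "odd n"
    and M_Symm: "M \<subseteq> Symm scale" and subspace_M: "form.subspace M" and dim_M: "form.dim M = 2 * n"
    and rank_M: "\<And>f. f \<in> M \<Longrightarrow> f \<noteq> 0 \<Longrightarrow> form_rank scale f \<ge> n - 2"
begin

lemma finite_V: "finite (UNIV :: 'v set)" and card_V: "card (UNIV :: 'v set) = CARD('k) ^ n"
  using card_subspace[OF subspace_UNIV] dim_V n_ge_3 by auto

lemma finite_M: "finite M" and card_M: "card M = CARD('k) ^ n * CARD('k) ^ n"
  using finite_field_space.card_subspace[OF finite_field_space_form_scale subspace_M] dim_M n_ge_3
  by (auto simp: power_add mult_2)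

lemma card_V_gt: "CARD('k) < CARD('k) ^ n" "0 < CARD('k) ^ n"
  using q_ge_2 n_ge_3 power_strict_increasing[of 1 n "CARD('k)"] by auto

lemma zero_in_M: "0 \<in> M" using subspace_M by (rule form.subspace_0)

lemma card_radical_M:
  assumes "f \<in> M"
  shows "card (form_radical f) = CARD('k) ^ (n - form_rank scale f)"
  using card_radical(2)[OF finite_V, of f] assms M_Symm dim_V by auto

lemma rank_le: "form_rank scale f \<le> n" using dim_V by (simp add: form_rank_def)

lemma card_radical_zero: "card (form_radical (0 :: 'v \<Rightarrow> 'v \<Rightarrow> 'k)) = CARD('k) ^ n"
  by (simp add: form_radical_def card_V)

lemma rank_alternating:
  assumes "f \<in> alternating_part M" "f \<noteq> 0"
  shows "form_rank scale f = n - 1"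
proof -
  have f: "f \<in> M" "\<And>u. f u u = 0" using assms(1) by (auto simp: alternating_part_def)
  have "even (form_rank scale f)" using even_rank_alternating[OF finite_V, of f] f M_Symm by blast
  moreover have "n - 2 \<le> form_rank scale f" "form_rank scale f \<le> n"
    using rank_M[OF f(1) assms(2)] rank_le by auto
  moreover have "odd (n - 2)" using odd_n n_ge_3 by simp
  ultimately have "form_rank scale f \<noteq> n - 2" "form_rank scale f \<noteq> n" using odd_n by auto
  with \<open>n - 2 \<le> form_rank scale f\<close> \<open>form_rank scale f \<le> n\<close> show ?thesis by linarith
qed

lemma alternating_part_facts:
  "alternating_part M \<subseteq> Symm scale" "form.subspace (alternating_part M)" "finite (alternating_part M)"
  "0 \<in> alternating_part M"
  using M_Symm finite_M form_subspace_alternating_part[OF subspace_M] form.subspace_0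
  by (auto simp: alternating_part_def)

text \<open>
  Write \<open>N\<close>, \<open>K\<close> for the orders of \<open>V\<close> and of the alternating part, and \<open>k u\<close> for the number of alternating
  forms that kill \<open>u\<close>. The diagonal map gives \<open>N \<le> K\<close>. Since non-zero alternating forms have a line as
  radical, the sum of all \<open>k u\<close> is known; since \<open>K * q \<le> N * k u\<close> for \<open>u \<noteq> 0\<close>, the sum is bounded below in
  terms of \<open>K\<close>. The two are compatible only if \<open>K \<le> N\<close>, and then all the lower bounds are equalities.
\<close>

lemma card_alternating_part: "card (alternating_part M) = CARD('k) ^ n"
  and card_alternating_killing: "u \<noteq> 0 \<Longrightarrow> card {f \<in> alternating_part M. f u = 0} = CARD('k)"
proof -
  let ?q = "CARD('k)" and ?A = "alternating_part M"
  let ?N = "?q ^ n" and ?K = "card ?A" and ?k = "\<lambda>u. card {f \<in> ?A. f u = 0}"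
  note A = alternating_part_facts
  have NK: "?N \<le> ?K"
    using card_le_card_alternating_part[OF finite_V M_Symm subspace_M finite_M char_two independent_empty]
      card_V_gt(2) by (simp add: card_V card_M)
  have "(\<Sum>u\<in>UNIV. ?k u) = (\<Sum>f\<in>?A. card (form_radical f))"
    by (rule sum_card_forms_killing[OF finite_V A(3)])
  also have "\<dots> = ?N + (\<Sum>f\<in>?A - {0}. card (form_radical f))"
    using A by (subst sum.remove[of _ 0]) (auto simp: card_radical_zero)
  also have "(\<Sum>f\<in>?A - {0}. card (form_radical f)) = (\<Sum>f\<in>?A - {0}. ?q)"
  proof (rule sum.cong)
    fix f assume "f \<in> ?A - {0}"
    then have "f \<in> M" "form_rank scale f = n - 1"
      using rank_alternating by (auto simp: alternating_part_def)
    then show "card (form_radical f) = ?q" using n_ge_3 card_radical_M by simp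
  qed simp
  also have "\<dots> = (?K - 1) * ?q" using A by simp
  finally have total: "(\<Sum>u\<in>UNIV. ?k u) = ?N + (?K - 1) * ?q" .
  have "(\<Sum>u\<in>UNIV. ?k u) = ?k 0 + (\<Sum>u\<in>UNIV - {0}. ?k u)"
    using finite_V by (subst sum.remove[of _ 0]) auto
  moreover have "{f \<in> ?A. f 0 = 0} = ?A"
    using A(1) by (auto simp: fun_eq_iff Symm_zero_left)
  ultimately have sum: "?K + (\<Sum>u\<in>UNIV - {0}. ?k u) = ?N + (?K - 1) * ?q"
    using total by simp
  have lower: "?K * ?q \<le> ?N * ?k u" if "u \<noteq> 0" for u
    using card_le_card_forms_killing[OF finite_V A(1,2,3), of "{u}" u] that
    by (simp add: card_V alternating_part_def)
  have cV: "card (UNIV - {0 :: 'v}) = ?N - 1" using finite_V card_V by simp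
  have "(?N - 1) * (?K * ?q) = (\<Sum>u\<in>UNIV - {0 :: 'v}. ?K * ?q)" using cV by simp
  also have "\<dots> \<le> (\<Sum>u\<in>UNIV - {0}. ?N * ?k u)" by (rule sum_mono) (use lower in simp)
  finally have le: "(?N - 1) * (?K * ?q) \<le> ?N * (\<Sum>u\<in>UNIV - {0}. ?k u)" by (simp add: sum_distrib_left)
  have K_pos: "?K \<ge> 1" using NK card_V_gt by simp
  have "?K \<le> ?N"
  proof -
    let ?S = "int (\<Sum>u\<in>UNIV - {0}. ?k u)"
    have "int ((?N - 1) * (?K * ?q)) \<le> int (?N * (\<Sum>u\<in>UNIV - {0}. ?k u))"
      using le by (simp only: of_nat_le_iff)
    then have le': "(int ?N - 1) * (int ?K * int ?q) \<le> int ?N * ?S"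
      using card_V_gt(2) by (simp add: of_nat_diff)
    have "int (?K + (\<Sum>u\<in>UNIV - {0}. ?k u)) = int (?N + (?K - 1) * ?q)" using sum by (rule arg_cong)
    then have S: "?S = int ?N + (int ?K - 1) * int ?q - int ?K"
      using K_pos by (simp add: of_nat_diff)
    have "int ?K * (int ?N - int ?q) \<le> int ?N * (int ?N - int ?q)"
      using le' unfolding S by (simp add: algebra_simps)
    moreover have "int ?N - int ?q > 0" using card_V_gt(1) by linarith
    ultimately show ?thesis by (simp only: mult_le_cancel_right_pos of_nat_le_iff)
  qed
  then show KN: "?K = ?N" using NK by simp
  show "?k u = ?q" if "u \<noteq> 0"
  proof (rule sum_le_imp_eq_lower_bound[where A = "UNIV - {0}" and g = ?k and a = u])
    show "finite (UNIV - {0 :: 'v})" using finite_V by simp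
    show "?q \<le> ?k u" if "u \<in> UNIV - {0}" for u
      using lower[of u] that card_V_gt(2) by (simp add: KN)
    have "(\<Sum>u\<in>UNIV - {0}. ?k u) = (?N - 1) * ?q" using sum by (simp add: KN)
    then show "(\<Sum>u\<in>UNIV - {0}. ?k u) \<le> card (UNIV - {0 :: 'v}) * ?q" by (simp add: cV)
  qed (use that in simp)
qed

definition M_killing :: "'v \<Rightarrow> ('v \<Rightarrow> 'v \<Rightarrow> 'k) set" where "M_killing u = {f \<in> M. f u = 0}"

lemma M_killing_facts:
  "M_killing u \<subseteq> Symm scale" "form.subspace (M_killing u)" "finite (M_killing u)" "0 \<in> M_killing u" "M_killing u \<subseteq> M"
  using M_Symm finite_M form_subspace_killing[OF subspace_M] zero_in_M
  by (auto simp: M_killing_def)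

text \<open>
  The lower bound compares \<open>M\<close> with the space of functionals \<open>f u\<close>. For the upper bound, the forms that
  kill \<open>u\<close> have diagonals vanishing at \<open>u\<close>, and only \<open>q\<close> of them are alternating.
\<close>

lemma card_M_killing:
  assumes "u \<noteq> 0"
  shows "card (M_killing u) = CARD('k) ^ n"
proof (rule antisym)
  let ?q = "CARD('k)"
  note A = M_killing_facts[of u]
  have "alternating_part (M_killing u) = {f \<in> alternating_part M. f u = 0}"
    by (auto simp: alternating_part_def M_killing_def)
  then have "card (M_killing u) * ?q \<le> ?q ^ n * ?q"
    using card_le_card_alternating_part[OF finite_V A(1,2,3) char_two, of "{u}"] assms
      card_alternating_killing[OF assms]
    by (simp add: card_V M_killing_def fun_eq_iff)
  then show "card (M_killing u) \<le> ?q ^ n" using q_ge_2 by simp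
  show "?q ^ n \<le> card (M_killing u)"
    using card_le_card_forms_killing[OF finite_V M_Symm subspace_M finite_M independent_empty, of u]
      card_V_gt(2) by (simp add: card_V card_M M_killing_def)
qed

lemma card_span_singleton: "u \<noteq> 0 \<Longrightarrow> card (span {u}) = CARD('k)"
  using card_span[of "{u}"] by simp

lemma M_killing_span:
  assumes "f \<in> M_killing u" "x \<in> span {u}"
  shows "f x = 0"
proof -
  obtain a where "x = scale a u" using assms(2) by (auto simp: span_singleton)
  then show ?thesis using assms(1) M_Symm
    by (auto simp: M_killing_def fun_eq_iff Symm_scale_left subset_iff)
qed

definition rank_count :: "'v \<Rightarrow> nat \<Rightarrow> nat"
  where "rank_count u r = card {f \<in> M_killing u. f \<noteq> 0 \<and> form_rank scale f = r}"

lemma rank_M_killing: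
  assumes "u \<noteq> 0" "f \<in> M_killing u" "f \<noteq> 0"
  shows "form_rank scale f = n - 1 \<or> form_rank scale f = n - 2"
proof -
  have "form_rank scale f \<noteq> n"
  proof
    assume "form_rank scale f = n"
    then have "card (form_radical f) = 1" using card_radical_M assms(2) M_killing_facts(5) by fastforce
    moreover have "{0, u} \<subseteq> form_radical f"
      using assms(2) M_Symm by (auto simp: form_radical_def M_killing_def fun_eq_iff subset_iff Symm_zero_left)
    then have "card {0, u} \<le> card (form_radical f)"
      using finite_subset[OF subset_UNIV finite_V] by (intro card_mono)
    ultimately show False using assms(1) by simp
  qed
  moreover have "n - 2 \<le> form_rank scale f" using rank_M assms M_killing_facts(5) by blast
  ultimately show ?thesis using rank_le[of f] by linarith
qed

lemma sum_M_killing: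
  fixes g :: "('v \<Rightarrow> 'v \<Rightarrow> 'k) \<Rightarrow> int"
  assumes u: "u \<noteq> 0"
    and a: "\<And>f. f \<in> M_killing u \<Longrightarrow> f \<noteq> 0 \<Longrightarrow> form_rank scale f = n - 1 \<Longrightarrow> g f = a"
    and b: "\<And>f. f \<in> M_killing u \<Longrightarrow> f \<noteq> 0 \<Longrightarrow> form_rank scale f = n - 2 \<Longrightarrow> g f = b"
  shows "(\<Sum>f\<in>M_killing u. g f) = g 0 + int (rank_count u (n - 1)) * a + int (rank_count u (n - 2)) * b"
proof -
  let ?E = "{f \<in> M_killing u. f \<noteq> 0 \<and> form_rank scale f = n - 1}"
  let ?O = "{f \<in> M_killing u. f \<noteq> 0 \<and> form_rank scale f = n - 2}"
  have "M_killing u - {0} = ?E \<union> ?O" using rank_M_killing[OF u] by blast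
  moreover have "?E \<inter> ?O = {}" using n_ge_3 by auto
  moreover have "finite ?E" "finite ?O" using M_killing_facts(3)[of u] by auto
  ultimately have "(\<Sum>f\<in>M_killing u - {0}. g f) = (\<Sum>f\<in>?E. g f) + (\<Sum>f\<in>?O. g f)"
    by (simp add: sum.union_disjoint)
  also have "(\<Sum>f\<in>?E. g f) = (\<Sum>f\<in>?E. a)" by (rule sum.cong) (use a in auto)
  also have "(\<Sum>f\<in>?O. g f) = (\<Sum>f\<in>?O. b)" by (rule sum.cong) (use b in auto)
  finally show ?thesis using sum.remove[OF M_killing_facts(3,4), of g u]
    by (simp only: rank_count_def sum_constant add.assoc)
qed

lemma rank_count_sum:
  assumes "u \<noteq> 0"
  shows "int CARD('k) ^ n = 1 + int (rank_count u (n - 1)) + int (rank_count u (n - 2))"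
  using sum_M_killing[OF assms, of "\<lambda>_. 1" 1 1] card_M_killing[OF assms] by simp

text \<open>
  Let \<open>Z f\<close> be the number of zeros of the elliptic value of \<open>f\<close>, and sum \<open>Z f\<close> over the \<open>N\<close> forms that
  kill \<open>u\<close>. Forms of rank \<open>n - 2\<close> have fewer zeros than average because \<open>n - 2\<close> is odd. On the other hand, every
  pair \<open>(x, y)\<close> is a zero for at least \<open>N / q\<close> of the forms, and a pair of multiples of \<open>u\<close> is a zero
  for all of them. So there cannot be too many forms of rank \<open>n - 2\<close>.
\<close>

lemma corank_two_count_le:
  assumes u: "u \<noteq> 0"
  shows "int (rank_count u (n - 2)) * int CARD('k) \<le> int CARD('k) ^ n - int CARD('k)"
proof -
  obtain c :: 'k where c: "\<And>x. x * x + x + c \<noteq> 0"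
    using exists_Artin_Schreier_irreducible[OF char_two] by blast
  let ?q = "int CARD('k)"
  let ?N = "?q ^ n" and ?E = "int (rank_count u (n - 1))" and ?O = "int (rank_count u (n - 2))"
  let ?Z = "\<lambda>f. card (elliptic_fibre c UNIV f 0)"
  let ?v = "\<lambda>f p. elliptic_value c f (fst p) (snd p)"
  let ?S = "span {u} \<times> span {u}"
  have Z: "?q * int (?Z f) = ?N ^ 2 + (- 1) ^ form_rank scale f * (?q - 1) * ?N * int (card (form_radical f))"
    if "f \<in> M_killing u" for f
    using card_elliptic_zeros_by_rank[OF char_two c finite_V, of f] that M_killing_facts(1) card_V by auto
  have even: "even (n - 1)" and odd: "odd (n - 2)" using odd_n n_ge_3 by simp_all
  have "(\<Sum>f\<in>M_killing u. ?q * int (?Z f)) =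
    ?q * ?N ^ 2 + ?E * (?N ^ 2 + (?q - 1) * ?N * ?q) + ?O * (?N ^ 2 - (?q - 1) * ?N * ?q ^ 2)"
  proof (subst sum_M_killing[OF u])
    fix f assume f: "f \<in> M_killing u" "form_rank scale f = n - 1"
    then show "?q * int (?Z f) = ?N ^ 2 + (?q - 1) * ?N * ?q"
      using Z[OF f(1)] card_radical_M[of f] M_killing_facts(5) n_ge_3 even by (auto simp: subset_iff)
  next
    fix f assume f: "f \<in> M_killing u" "form_rank scale f = n - 2"
    then show "?q * int (?Z f) = ?N ^ 2 - (?q - 1) * ?N * ?q ^ 2"
      using Z[OF f(1)] card_radical_M[of f] M_killing_facts(5) n_ge_3 odd by (auto simp: subset_iff algebra_simps)
  next
    have "elliptic_fibre c UNIV (0 :: 'v \<Rightarrow> 'v \<Rightarrow> 'k) 0 = UNIV \<times> UNIV"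
      by (auto simp: elliptic_fibre_def elliptic_value_def)
    then have "card (elliptic_fibre c UNIV (0 :: 'v \<Rightarrow> 'v \<Rightarrow> 'k) 0) = card (UNIV :: 'v set) * card (UNIV :: 'v set)"
      by (simp only: card_cartesian_product)
    then show "?q * int (card (elliptic_fibre c UNIV (0 :: 'v \<Rightarrow> 'v \<Rightarrow> 'k) 0)) + ?E * (?N ^ 2 + (?q - 1) * ?N * ?q)
       + ?O * (?N ^ 2 - (?q - 1) * ?N * ?q ^ 2) =
      ?q * ?N ^ 2 + ?E * (?N ^ 2 + (?q - 1) * ?N * ?q) + ?O * (?N ^ 2 - (?q - 1) * ?N * ?q ^ 2)"
      by (simp add: card_V power2_eq_square)
  qed
  moreover have "?q ^ 2 * (?q * ?N) + (?N ^ 2 - ?q ^ 2) * ?N \<le> (\<Sum>f\<in>M_killing u. ?q * int (?Z f))"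
  proof -
    \<comment> \<open>on \<open>?S\<close>, the pairs of multiples of \<open>u\<close>, every form that kills \<open>u\<close> takes the value 0\<close>
    have finP: "finite (UNIV :: ('v \<times> 'v) set)" using finite_V by (simp add: finite_prod)
    have S: "card ?S = CARD('k) ^ 2" "?S \<subseteq> UNIV" "finite ?S"
      using card_span_singleton[OF u] finite_V finite_subset[OF subset_UNIV] 
      by (auto simp: card_cartesian_product power2_eq_square)
    have cP: "card (UNIV :: ('v \<times> 'v) set) = card (UNIV :: 'v set) ^ 2"
      using card_cartesian_product[of "UNIV :: 'v set" "UNIV :: 'v set"] by (simp add: power2_eq_square)
    have "(\<Sum>f\<in>M_killing u. ?Z f) = (\<Sum>f\<in>M_killing u. card {p \<in> UNIV. ?v f p = 0})"
      by (simp add: elliptic_fibre_def)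
    also have "\<dots> = (\<Sum>p\<in>UNIV. card {f \<in> M_killing u. ?v f p = 0})"
      by (rule sum_card_swap[OF M_killing_facts(3) finP])
    also have "\<dots> = (\<Sum>p\<in>?S. card {f \<in> M_killing u. ?v f p = 0}) + (\<Sum>p\<in>UNIV - ?S. card {f \<in> M_killing u. ?v f p = 0})"
      using sum.subset_diff[OF S(2) finP] by (simp add: add.commute)
    finally have "(\<Sum>f\<in>M_killing u. int (?Z f)) = (\<Sum>p\<in>?S. int (card {f \<in> M_killing u. ?v f p = 0})) +
      (\<Sum>p\<in>UNIV - ?S. int (card {f \<in> M_killing u. ?v f p = 0}))"
      by (simp only: flip: of_nat_sum of_nat_add)
    then have split: "(\<Sum>f\<in>M_killing u. ?q * int (?Z f)) = (\<Sum>p\<in>?S. ?q * int (card {f \<in> M_killing u. ?v f p = 0})) +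
      (\<Sum>p\<in>UNIV - ?S. ?q * int (card {f \<in> M_killing u. ?v f p = 0}))"
      by (simp only: distrib_left flip: sum_distrib_left)
    have "(\<Sum>p\<in>?S. ?q * int (card {f \<in> M_killing u. ?v f p = 0})) = (\<Sum>p\<in>?S. ?q * ?N)"
    proof (rule sum.cong)
      fix p assume "p \<in> ?S"
      then have "{f \<in> M_killing u. ?v f p = 0} = M_killing u"
        using M_killing_span by (fastforce simp: elliptic_value_def)
      then show "?q * int (card {f \<in> M_killing u. ?v f p = 0}) = ?q * ?N" using card_M_killing[OF u] by simp
    qed simp
    also have "\<dots> = ?q ^ 2 * (?q * ?N)" using S by simp
    finally have 1: "(\<Sum>p\<in>?S. ?q * int (card {f \<in> M_killing u. ?v f p = 0})) = ?q ^ 2 * (?q * ?N)" .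
    have "(\<Sum>p\<in>UNIV - ?S. ?N) \<le> (\<Sum>p\<in>UNIV - ?S. ?q * int (card {f \<in> M_killing u. ?v f p = 0}))"
    proof (rule sum_mono)
      fix p :: "'v \<times> 'v"
      have "card (M_killing u) \<le> CARD('k) * card {f \<in> M_killing u. ?v f p = 0}"
        by (rule finite_field_space.card_le_level[OF finite_field_space_form_scale M_killing_facts(2,3)])
          (simp_all add: elliptic_value_def form_scale_def algebra_simps)
      then have "int (card (M_killing u)) \<le> int (CARD('k) * card {f \<in> M_killing u. ?v f p = 0})"
        by (simp only: of_nat_le_iff)
      then show "?N \<le> ?q * int (card {f \<in> M_killing u. ?v f p = 0})" by (simp add: card_M_killing[OF u])
    qed
    moreover have "(\<Sum>p\<in>UNIV - ?S. ?N) = (?N ^ 2 - ?q ^ 2) * ?N"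
    proof -
      have "card (UNIV - ?S) = card (UNIV :: ('v \<times> 'v) set) - card ?S" by (rule card_Diff_subset[OF S(3,2)])
      moreover have "card ?S \<le> card (UNIV :: ('v \<times> 'v) set)" by (rule card_mono[OF finP S(2)])
      ultimately have "int (card (UNIV - ?S)) = ?N ^ 2 - ?q ^ 2"
        using S(1) cP by (simp add: card_V of_nat_diff)
      then show ?thesis by simp
    qed
    ultimately show ?thesis using split 1 by simp
  qed
  ultimately have L: "?q ^ 2 * (?q * ?N) + (?N ^ 2 - ?q ^ 2) * ?N \<le>
    ?q * ?N ^ 2 + ?E * (?N ^ 2 + (?q - 1) * ?N * ?q) + ?O * (?N ^ 2 - (?q - 1) * ?N * ?q ^ 2)"
    by (simp only:)
  have E: "?E = ?N - 1 - ?O" using rank_count_sum[OF u] by simp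
  \<comment> \<open>the sum over all forms, cleared of its common factor\<close>
  have equiv: "(x ^ 2 * (x * N) + (N ^ 2 - x ^ 2) * N \<le>
    x * N ^ 2 + (N - 1 - t) * (N ^ 2 + (x - 1) * N * x) + t * (N ^ 2 - (x - 1) * N * x ^ 2)) \<longleftrightarrow>
    ((x - 1) * N * (x + 1)) * (t * x) \<le> ((x - 1) * N * (x + 1)) * (N - x)" for x N t :: int
    by (simp add: algebra_simps power2_eq_square)
  have "((?q - 1) * ?N * (?q + 1)) * (?O * ?q) \<le> ((?q - 1) * ?N * (?q + 1)) * (?N - ?q)"
    using L unfolding E by (simp only: equiv)
  moreover have "(?q - 1) * ?N * (?q + 1) > 0" using q_ge_2 by simp
  ultimately show ?thesis by (simp only: mult_le_cancel_left_pos)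
qed

text \<open>
  At least \<open>q\<close> of the \<open>N\<close> forms that kill \<open>u\<close> also kill \<open>w\<close>, because \<open>f w\<close> is then a functional vanishing
  at \<open>u\<close>. Summed over all \<open>w\<close> outside the line of \<open>u\<close>, the bound on the number of forms of rank \<open>n - 2\<close> is
  precisely what excludes a strict inequality for any single \<open>w\<close>.
\<close>

lemma card_two_killing:
  assumes u: "u \<noteq> 0" and w: "w \<notin> span {u}"
  shows "card {f \<in> M. f u = 0 \<and> f w = 0} = CARD('k)"
proof -
  let ?q = "CARD('k)" and ?k = "\<lambda>w. card {f \<in> M_killing u. f w = 0}"
  have finS: "finite (span {u})" using finite_V finite_subset[OF subset_UNIV] by blast
  have "?k w = ?q"
  proof (rule sum_le_imp_eq_lower_bound[where A = "UNIV - span {u}" and g = ?k and a = w])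
    show "finite (UNIV - span {u})" using finite_V by simp
    show "?q \<le> ?k x" for x
    proof -
      have "card (M_killing u) * ?q \<le> ?q ^ n * ?k x"
      proof -
        have "f x y = 0" if "f \<in> M_killing u" "y \<in> {u}" for f y
          using that M_killing_facts(1) Symm_commute[of f x u] by (auto simp: M_killing_def)
        then show ?thesis
          using card_le_card_forms_killing[OF finite_V M_killing_facts(1,2,3), of "{u}" u x] u
          by (simp add: card_V)
      qed
      then show ?thesis using card_M_killing[OF u] card_V_gt(2) by simp
    qed
    have "(\<Sum>x\<in>UNIV. ?k x) = (\<Sum>f\<in>M_killing u. card (form_radical f))"
      by (rule sum_card_forms_killing[OF finite_V M_killing_facts(3)])
    then have "(\<Sum>x\<in>UNIV. int (?k x)) = (\<Sum>f\<in>M_killing u. int (card (form_radical f)))"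
      by (simp flip: of_nat_sum)
    also have "\<dots> = int ?q ^ n + int (rank_count u (n - 1)) * int ?q + int (rank_count u (n - 2)) * int ?q ^ 2"
      using M_killing_facts(5) n_ge_3
      by (subst sum_M_killing[OF u, where a = "int ?q" and b = "int ?q ^ 2"])
        (auto simp: card_radical_zero card_radical_M subset_iff)
    finally have total: "(\<Sum>x\<in>UNIV. int (?k x)) = \<dots>" .
    have "(\<Sum>x\<in>UNIV. int (?k x)) = (\<Sum>x\<in>UNIV - span {u}. int (?k x)) + (\<Sum>x\<in>span {u}. int (?k x))"
      by (rule sum.subset_diff) (use finite_V in auto)
    also have "(\<Sum>x\<in>span {u}. int (?k x)) = (\<Sum>x\<in>span {u}. int ?q ^ n)"
    proof (rule sum.cong)
      fix x assume "x \<in> span {u}"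
      then have "{f \<in> M_killing u. f x = 0} = M_killing u" using M_killing_span by blast
      then show "int (?k x) = int ?q ^ n" using card_M_killing[OF u] by simp
    qed simp
    also have "\<dots> = int ?q * int ?q ^ n" using card_span_singleton[OF u] by simp
    finally have "(\<Sum>x\<in>UNIV - span {u}. int (?k x)) = int ?q ^ n + int (rank_count u (n - 1)) * int ?q
      + int (rank_count u (n - 2)) * int ?q ^ 2 - int ?q * int ?q ^ n"
      using total by linarith
    also have "\<dots> = int ?q ^ n - int ?q + (int ?q - 1) * (int (rank_count u (n - 2)) * int ?q)"
      unfolding rank_count_sum[OF u] by (simp add: algebra_simps power2_eq_square)
    also have "\<dots> \<le> int ?q ^ n - int ?q + (int ?q - 1) * (int ?q ^ n - int ?q)"
      using corank_two_count_le[OF u] q_ge_2 by (intro add_left_mono mult_left_mono) auto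
    also have "\<dots> = (int ?q ^ n - int ?q) * int ?q" by (simp add: algebra_simps)
    also have "\<dots> = int (card (UNIV - span {u}) * ?q)"
      using card_Diff_subset[OF finS subset_UNIV] card_V card_span_singleton[OF u] card_V_gt(1)
      by (simp add: of_nat_diff)
    finally show "(\<Sum>x\<in>UNIV - span {u}. ?k x) \<le> card (UNIV - span {u}) * ?q"
      by (simp only: of_nat_le_iff flip: of_nat_sum)
  qed (use w in simp)
  then show ?thesis by (simp add: M_killing_def conj_assoc)
qed

end

section \<open>Isotropic vectors of a pencil\<close>

context finite_field_space
begin

lemma Symm_sum_left:
  assumes f: "f \<in> Symm scale"
  shows "f (\<Sum>i\<in>I. x i) z = (\<Sum>i\<in>I. f (x i) z)"
  by (induction I rule: infinite_finite_induct) (simp_all add: Symm_simps[OF f])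

lemma separating_functional:
  assumes "w \<noteq> 0"
  obtains \<psi> :: "'v \<Rightarrow> 'k" where "\<And>x y. \<psi> (x + y) = \<psi> x + \<psi> y"
    "\<And>c x. \<psi> (scale c x) = c * \<psi> x" "\<psi> w \<noteq> 0"
proof -
  have ind: "independent {w}" using assms by simp
  let ?B = "extend_basis {w}"
  have B: "independent ?B" "span ?B = UNIV" "w \<in> ?B"
    using independent_extend_basis[OF ind] extend_basis_superset[OF ind] ind by simp_all
  show ?thesis
  proof (rule that[of "\<lambda>y. representation ?B y w"])
    show "representation ?B (x + y) w = representation ?B x w + representation ?B y w" for x y
      using representation_add[OF B(1)] B(2) by simp
    show "representation ?B (scale c x) w = c * representation ?B x w" for c x
      using representation_scale[OF B(1)] B(2) by simp
    show "representation ?B w w \<noteq> 0"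
      using representation_basis[OF B(1,3)] by simp
  qed
qed

text \<open>
  Eigenvectors for distinct eigenvalues are independent: each \<open>x c\<close> is an eigenvector, with eigenvalue
  \<open>- c\<close>, of \<open>g\<close> relative to \<open>f\<close>. The condition that no non-zero element of \<open>K\<close> lies in the radical of \<open>f\<close>
  replaces invertibility of \<open>f\<close>.
\<close>

lemma pencil_eigenvectors_independent:
  assumes f: "f \<in> Symm scale" and g: "g \<in> Symm scale" and K: "subspace K"
    and triv: "\<And>y. y \<in> K \<Longrightarrow> (\<And>z. f y z = 0) \<Longrightarrow> y = 0"
    and x: "\<And>c. x c \<in> K" "\<And>c. x c \<noteq> 0" "\<And>c z. g (x c) z + c * f (x c) z = 0"
    and "finite C" and "(\<Sum>c\<in>C. scale (\<alpha> c) (x c)) = 0"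
  shows "\<forall>c\<in>C. \<alpha> c = 0"
  using assms(8,9)
proof (induction C arbitrary: \<alpha> rule: finite_induct)
  case (insert a C)
  let ?C = "insert a C"
  let ?\<beta> = "\<lambda>c. (c - a) * \<alpha> c"
  have "(\<Sum>c\<in>C. scale (?\<beta> c) (x c)) = 0"
  proof (rule triv)
    show "(\<Sum>c\<in>C. scale (?\<beta> c) (x c)) \<in> K" using K x(1) by (intro subspace_sum subspace_scale)
    fix z
    have gx: "g (x c) z = - (c * f (x c) z)" for c using x(3)[of c z] by (simp only: eq_neg_iff_add_eq_0)
    have F: "(\<Sum>c\<in>?C. \<alpha> c * f (x c) z) = 0"
      using arg_cong[OF insert.prems, of "\<lambda>v. f v z"] by (simp only: Symm_sum_left[OF f] Symm_simps[OF f])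
    have "(\<Sum>c\<in>?C. \<alpha> c * g (x c) z) = 0"
      using arg_cong[OF insert.prems, of "\<lambda>v. g v z"] by (simp only: Symm_sum_left[OF g] Symm_simps[OF g])
    then have G: "(\<Sum>c\<in>?C. c * (\<alpha> c * f (x c) z)) = 0"
      by (simp only: gx mult_minus_right sum_negf neg_equal_0_iff_equal mult.left_commute)
    have "(\<Sum>c\<in>?C. ?\<beta> c * f (x c) z) =
      (\<Sum>c\<in>?C. c * (\<alpha> c * f (x c) z)) - a * (\<Sum>c\<in>?C. \<alpha> c * f (x c) z)"
      by (simp only: sum_distrib_left left_diff_distrib sum_subtractf mult.assoc)
    also have "\<dots> = 0" by (simp only: F G mult_zero_right diff_0_right)
    finally have "(\<Sum>c\<in>?C. ?\<beta> c * f (x c) z) = 0" .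
    then have "(\<Sum>c\<in>C. ?\<beta> c * f (x c) z) = 0" using insert.hyps by simp
    then show "f (\<Sum>c\<in>C. scale (?\<beta> c) (x c)) z = 0"
      by (simp only: Symm_sum_left[OF f] Symm_simps[OF f])
  qed
  then have "\<forall>c\<in>C. ?\<beta> c = 0" by (rule insert.IH)
  then have C0: "\<forall>c\<in>C. \<alpha> c = 0" using insert.hyps by auto
  then have "scale (\<alpha> a) (x a) = 0" using insert by simp
  then show ?case using C0 x(2) by simp
qed simp

text \<open>
  Suppose \<open>g w w \<noteq> 0\<close>. Then some non-zero \<open>w'\<close> in the radical plane of \<open>f\<close> is orthogonal to \<open>w\<close> under
  \<open>g\<close>. Choose a functional \<open>\<psi>\<close> with \<open>\<psi> w' \<noteq> 0\<close> and let \<open>K\<close> be defined by \<open>g w y = 0\<close> and \<open>\<psi> y = 0\<close>, a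
  complement of that plane. For every \<open>c\<close> the radical plane of \<open>g + c f\<close> is already orthogonal to
  \<open>w\<close> under \<open>g\<close>, as \<open>f w = 0\<close>; hence it meets \<open>K\<close> in a non-zero vector, as only the condition on \<open>\<psi>\<close>
  remains. These vectors, one for each field element, are independent, so the order of the field is at
  most the dimension of \<open>V\<close> minus 2.
\<close>

lemma radical_isotropic_in_pencil:
  assumes fin: "finite (UNIV :: 'v set)" and f: "f \<in> Symm scale" and g: "g \<in> Symm scale"
    and rf: "card (form_radical f) = CARD('k) ^ 2"
    and rg: "\<And>c. card (form_radical (g + form_scale c f)) = CARD('k) ^ 2"
    and big: "CARD('k) + 1 \<ge> dim (UNIV :: 'v set)"
    and w: "f w = 0"
  shows "g w w = 0"
proof (rule ccontr)
  assume gw: "g w w \<noteq> 0"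
  let ?q = "CARD('k)" and ?R = "form_radical f"
  have finS: "finite A" for A :: "'v set" using fin finite_subset[OF subset_UNIV] by blast
  have R: "subspace ?R" by (rule subspace_radical[OF f])
  have exists_nz: "\<exists>y\<in>A. y \<noteq> 0" if "?q \<le> card A" for A :: "'v set"
  proof (rule ccontr)
    assume "\<not> ?thesis"
    then have "A \<subseteq> {0}" by blast
    then have "card A \<le> 1" using card_mono[of "{0}" A] by simp
    then show False using that q_ge_2 by simp
  qed
  define R1 where "R1 = {x \<in> ?R. g w x = 0}"
  have R1: "subspace R1" unfolding R1_def by (rule subspace_perp[OF g R])
  have "card ?R = ?q * card R1" unfolding R1_def
    by (rule card_perp[OF g R finS, of w]) (use w gw in \<open>auto simp: form_radical_alt_def\<close>)
  then have cR1: "card R1 = ?q" using rf q_ge_2 by (simp add: power2_eq_square)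
  then obtain w' where w': "w' \<in> R1" "w' \<noteq> 0" using exists_nz[of R1] by auto
  obtain \<psi> :: "'v \<Rightarrow> 'k" where psi: "\<And>x y. \<psi> (x + y) = \<psi> x + \<psi> y"
    "\<And>c x. \<psi> (scale c x) = c * \<psi> x" "\<psi> w' \<noteq> 0"
    using separating_functional[OF w'(2)] by blast
  have psi0: "\<psi> 0 = 0" using psi(2)[of 0 0] by simp
  define K where "K = {y. g w y = 0 \<and> \<psi> y = 0}"
  have K: "subspace K" by (auto simp: subspace_def K_def psi psi0 Symm_simps[OF g])
  have triv: "y = 0" if y: "y \<in> K" "\<And>z. f y z = 0" for y
  proof -
    have "card R1 = ?q * card {x \<in> R1. \<psi> x = 0}"
      by (rule card_level_surj[OF R1 finS, where \<sigma> = "\<lambda>c. c" and w = w'])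
        (simp_all add: psi w' surj_def)
    then have "card {x \<in> R1. \<psi> x = 0} = 1" using cR1 q_ge_2 by simp
    then obtain z where z: "{x \<in> R1. \<psi> x = 0} = {z}" by (rule card_1_singletonE)
    have "y \<in> {x \<in> R1. \<psi> x = 0}" using y by (simp add: R1_def K_def form_radical_def)
    moreover have "0 \<in> {x \<in> R1. \<psi> x = 0}" using subspace_0[OF R1] psi0 by simp
    ultimately show "y = 0" using z by auto
  qed
  \<comment> \<open>an eigenvector in \<open>K\<close> for every \<open>c\<close>\<close>
  have "\<exists>x. x \<in> K \<and> x \<noteq> 0 \<and> (\<forall>z. g x z + c * f x z = 0)" for c
  proof -
    let ?h = "g + form_scale c f"
    let ?Rc = "form_radical ?h"
    have Rc: "y \<in> ?Rc \<longleftrightarrow> (\<forall>z. g y z + c * f y z = 0)" for y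
      by (simp add: form_radical_def form_scale_def)
    define H where "H y z = g y z + c * f y z" for y z
    have H: "H 0 z = 0" "H (x + y) z = H x z + H y z" "H (scale a x) z = a * H x z" for x y z a
      by (simp_all add: H_def Symm_simps[OF f] Symm_simps[OF g] algebra_simps)
    have sub: "subspace ?Rc" unfolding subspace_def by (auto simp: Rc H simp flip: H_def)
    have "card ?Rc \<le> ?q * card {x \<in> ?Rc. \<psi> x = 0}"
      by (rule card_le_level[OF sub finS]) (simp_all add: psi)
    then have "?q \<le> card {x \<in> ?Rc. \<psi> x = 0}" using rg[of c] q_ge_2 by (simp add: power2_eq_square)
    then obtain x where x: "x \<in> ?Rc" "\<psi> x = 0" "x \<noteq> 0" using exists_nz by blast
    have "f x w = 0" using w Symm_commute[OF f, of x w] by simp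
    then have "g x w = 0" using x(1)[unfolded Rc, rule_format, of w] by simp
    then have "g w x = 0" using Symm_commute[OF g, of x w] by simp
    then show ?thesis using x Rc by (auto simp: K_def)
  qed
  then obtain x where x: "\<And>c. x c \<in> K" "\<And>c. x c \<noteq> 0" "\<And>c z. g (x c) z + c * f (x c) z = 0"
    by metis
  let ?h = "\<lambda>\<alpha>. \<Sum>c\<in>UNIV. scale (\<alpha> c) (x c)"
  have "inj ?h"
  proof (rule injI)
    fix \<alpha> \<beta> :: "'k \<Rightarrow> 'k" assume "?h \<alpha> = ?h \<beta>"
    then have "(\<Sum>c\<in>UNIV. scale (\<alpha> c - \<beta> c) (x c)) = 0"
      by (simp add: scale_left_diff_distrib sum_subtractf)
    note zero = this
    have "\<forall>c\<in>UNIV. \<alpha> c - \<beta> c = 0"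
    proof (rule pencil_eigenvectors_independent[OF f g K, of x UNIV "\<lambda>c. \<alpha> c - \<beta> c"])
      show "y = 0" if "y \<in> K" "\<And>z. f y z = 0" for y using that by (rule triv)
      show "(\<Sum>c\<in>UNIV. scale (\<alpha> c - \<beta> c) (x c)) = 0" by (rule zero)
    qed (rule x finite)+
    then show "\<alpha> = \<beta>" by (simp add: fun_eq_iff)
  qed
  moreover have "range ?h \<subseteq> K" by (rule image_subsetI, rule subspace_sum[OF K], rule subspace_scale[OF K], rule x(1))
  ultimately have "CARD('k \<Rightarrow> 'k) \<le> card K" using finS by (rule card_inj_on_le)
  then have cK: "?q ^ ?q \<le> card K" by (simp add: card_fun)
  \<comment> \<open>\<open>K\<close> and the radical of \<open>f\<close> are independent, which bounds the dimension of \<open>K\<close>\<close>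
  have "inj_on (\<lambda>(y, r). y + r) (K \<times> ?R)"
  proof (rule inj_onI, clarify)
    fix y r y' r' assume a: "y \<in> K" "r \<in> ?R" "y' \<in> K" "r' \<in> ?R" "y + r = y' + r'"
    have d: "y - y' = r' - r" using a(5) by (simp add: algebra_simps)
    have "y - y' \<in> K" using K a by (simp add: subspace_diff)
    moreover have "y - y' \<in> ?R" unfolding d using R a by (simp add: subspace_diff)
    ultimately have "y - y' = 0" by (intro triv) (auto simp: form_radical_def)
    then show "y = y' \<and> r = r'" using a(5) by simp
  qed
  then have "card (K \<times> ?R) \<le> card (UNIV :: 'v set)" using fin by (intro card_inj_on_le) auto
  moreover have "?q ^ ?q * ?q ^ 2 \<le> card (K \<times> ?R)"
    unfolding card_cartesian_product rf by (rule mult_le_mono1[OF cK])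
  ultimately have "?q ^ ?q * ?q ^ 2 \<le> card (UNIV :: 'v set)" by (rule le_trans[rotated])
  also have "\<dots> = ?q ^ dim (UNIV :: 'v set)" using card_subspace[OF subspace_UNIV] fin by blast
  finally have "?q ^ (?q + 2) \<le> ?q ^ dim (UNIV :: 'v set)" by (simp only: power_add)
  then have "?q + 2 \<le> dim (UNIV :: 'v set)" using q_ge_2 by (intro power_le_imp_le_exp) auto
  then show False using big by simp
qed

end

section \<open>Subspaces of constant rank n - 2\<close>

context minimum_rank_space
begin

context
  fixes U :: "('v \<Rightarrow> 'v \<Rightarrow> 'k) set"
  assumes U_M: "U \<subseteq> M" and U: "constant_rank_subspace scale (n - 2) U"
    and big: "CARD('k) \<ge> n - 1"
begin

lemma U_facts: "form.subspace U" "finite U" "0 \<in> U" "U \<subseteq> Symm scale" "U \<noteq> {0}"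
  using U U_M finite_M finite_subset form.subspace_0 by (auto simp: constant_rank_subspace_def)

lemma card_radical_U:
  assumes "f \<in> U" "f \<noteq> 0"
  shows "card (form_radical f) = CARD('k) ^ 2"
proof -
  have "form_rank scale f = n - 2" using U assms by (simp add: constant_rank_subspace_def)
  moreover have "n - (n - 2) = 2" using n_ge_3 by simp
  ultimately show ?thesis using card_radical_M U_M assms(1) by (simp add: subset_iff)
qed

text \<open>
  If \<open>g\<close> is a multiple of \<open>f\<close>, it kills \<open>w\<close> too. Otherwise every member \<open>g + c f\<close> of the pencil is a non-zero element of \<open>U\<close>.
\<close>

lemma radical_isotropic:
  assumes f: "f \<in> U" "f \<noteq> 0" and g: "g \<in> U" and w: "f w = 0"
  shows "g w w = 0"
proof (cases "\<exists>c. g = form_scale c f")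
  case True
  then show ?thesis using w by (auto simp: form_scale_def)
next
  case False
  have "card (form_radical (g + form_scale c f)) = CARD('k) ^ 2" for c
  proof (rule card_radical_U)
    show "g + form_scale c f \<in> U" using f g U_facts(1) by (simp add: form.subspace_add form.subspace_scale)
    show "g + form_scale c f \<noteq> 0"
    proof
      assume "g + form_scale c f = 0"
      then have "g = - form_scale c f" by (simp only: eq_neg_iff_add_eq_0)
      then have "g = form_scale (- c) f" by (simp only: form.scale_minus_left)
      then show False using False by blast
    qed
  qed
  moreover have "f \<in> Symm scale" "g \<in> Symm scale" using f g U_facts(4) by auto
  ultimately show ?thesis
    using radical_isotropic_in_pencil[OF finite_V, of f g w] card_radical_U[OF f] w big dim_V n_ge_3
    by simp
qed

definition isotropic_locus :: "'v set" where "isotropic_locus = {x. \<forall>g\<in>U. g x x = 0}"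

lemma finite_isotropic_locus: "finite isotropic_locus" using finite_subset[OF subset_UNIV finite_V] .

lemma radical_subset_isotropic_locus: "f \<in> U \<Longrightarrow> f \<noteq> 0 \<Longrightarrow> form_radical f \<subseteq> isotropic_locus"
  using radical_isotropic by (auto simp: isotropic_locus_def form_radical_alt_def)

text \<open>
  Count the pairs of \<open>x\<close> in \<open>V\<close> and \<open>g\<close> in \<open>U\<close> with \<open>g x x = 0\<close> in both ways. A non-zero \<open>g\<close> in \<open>U\<close> is not
  alternating, having the wrong rank, so its diagonal vanishes on the \<open>q\<close>-th part of \<open>V\<close>. A vector outside
  the locus is isotropic for the \<open>q\<close>-th part of \<open>U\<close>.
\<close>

lemma card_isotropic_locus: "card isotropic_locus * card U = CARD('k) ^ n"
proof -
  let ?q = "CARD('k)"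
  have "(\<Sum>x\<in>UNIV. card {g \<in> U. g x x = 0}) = (\<Sum>g\<in>U. card {x \<in> UNIV. g x x = 0})"
    by (rule sum_card_swap[OF finite_V U_facts(2)])
  then have eq: "(\<Sum>x\<in>UNIV. ?q * card {g \<in> U. g x x = 0}) = (\<Sum>g\<in>U. ?q * card {x \<in> UNIV. g x x = 0})"
    by (simp flip: sum_distrib_left)
  have "(\<Sum>x\<in>UNIV. ?q * card {g \<in> U. g x x = 0}) =
    (\<Sum>x\<in>UNIV - isotropic_locus. ?q * card {g \<in> U. g x x = 0}) + (\<Sum>x\<in>isotropic_locus. ?q * card {g \<in> U. g x x = 0})"
    by (rule sum.subset_diff) (use finite_V in auto)
  also have "(\<Sum>x\<in>isotropic_locus. ?q * card {g \<in> U. g x x = 0}) = (\<Sum>x\<in>isotropic_locus. ?q * card U)"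
  proof (rule sum.cong)
    fix x assume "x \<in> isotropic_locus"
    then have "{g \<in> U. g x x = 0} = U" by (auto simp: isotropic_locus_def)
    then show "?q * card {g \<in> U. g x x = 0} = ?q * card U" by simp
  qed simp
  also have "(\<Sum>x\<in>UNIV - isotropic_locus. ?q * card {g \<in> U. g x x = 0}) = (\<Sum>x\<in>UNIV - isotropic_locus. card U)"
  proof (rule sum.cong)
    fix x assume "x \<in> UNIV - isotropic_locus"
    then obtain g where g: "g \<in> U" "g x x \<noteq> 0" by (auto simp: isotropic_locus_def)
    have "card U = ?q * card {g \<in> U. g x x = 0}"
      by (rule finite_field_space.card_level_surj[OF finite_field_space_form_scale U_facts(1,2),
            where \<sigma> = "\<lambda>c. c" and w = g])
        (use g in \<open>auto simp: form_scale_def surj_def\<close>)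
    then show "?q * card {g \<in> U. g x x = 0} = card U" by simp
  qed simp
  finally have left: "(\<Sum>x\<in>UNIV. ?q * card {g \<in> U. g x x = 0}) =
    card (UNIV - isotropic_locus) * card U + card isotropic_locus * (?q * card U)" by simp
  have "(\<Sum>g\<in>U. ?q * card {x \<in> UNIV. g x x = 0}) =
    ?q * card {x \<in> (UNIV :: 'v set). (0 :: 'v \<Rightarrow> 'v \<Rightarrow> 'k) x x = 0} + (\<Sum>g\<in>U - {0}. ?q * card {x \<in> UNIV. g x x = 0})"
    by (rule sum.remove[OF U_facts(2,3)])
  also have "(\<Sum>g\<in>U - {0}. ?q * card {x \<in> UNIV. g x x = 0}) = (\<Sum>g\<in>U - {0}. ?q ^ n)"
  proof (rule sum.cong)
    fix g assume g: "g \<in> U - {0}"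
    then have gS: "g \<in> Symm scale" using U_facts(4) by blast
    have "g \<notin> alternating_part M"
      using rank_alternating[of g] g U n_ge_3 by (auto simp: constant_rank_subspace_def)
    then obtain v where v: "g v v \<noteq> 0" using g U_M by (auto simp: alternating_part_def)
    have "card (UNIV :: 'v set) = ?q * card {x \<in> UNIV. g x x = 0}"
    proof (rule card_level_surj[OF subspace_UNIV finite_V, where \<sigma> = "\<lambda>c. c * c" and w = v])
      show "g (x + y) (x + y) = g x x + g y y" for x y
      proof -
        have "g x y + g x y = 0" by (simp only: add_eq_0_iff_char_two[OF char_two])
        moreover have "g (x + y) (x + y) = g x x + (g x y + g x y) + g y y"
          using Symm_commute[OF gS, of y x] by (simp add: Symm_simps[OF gS] algebra_simps)
        ultimately show ?thesis by (simp only: add_0_right)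
      qed
      show "surj (\<lambda>c. c * c :: 'k)" by (rule surj_square_char_two[OF char_two])
    qed (use v in \<open>simp_all add: Symm_simps[OF gS]\<close>)
    then show "?q * card {x \<in> UNIV. g x x = 0} = ?q ^ n" by (simp add: card_V)
  qed simp
  also have "\<dots> = (card U - 1) * ?q ^ n" using U_facts by simp
  also have "card {x \<in> (UNIV :: 'v set). (0 :: 'v \<Rightarrow> 'v \<Rightarrow> 'k) x x = 0} = ?q ^ n" by (simp add: card_V)
  finally have right: "(\<Sum>g\<in>U. ?q * card {x \<in> UNIV. g x x = 0}) = ?q * ?q ^ n + (card U - 1) * ?q ^ n" .
  have posU: "1 \<le> card U" using U_facts by (simp add: Suc_le_eq card_gt_0_iff) blast
  have cVW: "int (card (UNIV - isotropic_locus)) = int ?q ^ n - int (card isotropic_locus)"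
    using card_Diff_subset[OF finite_isotropic_locus subset_UNIV] card_mono[OF finite_V subset_UNIV, of isotropic_locus] card_V
    by (simp add: of_nat_diff)
  have "int (card (UNIV - isotropic_locus) * card U + card isotropic_locus * (?q * card U)) = int (?q * ?q ^ n + (card U - 1) * ?q ^ n)"
    using eq left right by simp
  then have "(int ?q ^ n - int (card isotropic_locus)) * int (card U) + int (card isotropic_locus) * (int ?q * int (card U)) =
    int ?q * int ?q ^ n + (int (card U) - 1) * int ?q ^ n"
    using posU by (simp add: cVW of_nat_diff)
  then have "(int ?q - 1) * (int (card isotropic_locus) * int (card U)) = (int ?q - 1) * int ?q ^ n"
    by (simp add: algebra_simps)
  moreover have "int ?q - 1 \<noteq> 0" using q_ge_2 by simp
  ultimately have "int (card isotropic_locus) * int (card U) = int ?q ^ n" using mult_left_cancel by blast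
  then show ?thesis by (metis of_nat_eq_iff of_nat_mult of_nat_power)
qed

text \<open>
  Count the pairs of a non-zero \<open>f\<close> in \<open>U\<close> killing \<open>u\<close> and a vector \<open>w\<close>, outside the line of \<open>u\<close>, that \<open>f\<close>
  also kills. Such a \<open>w\<close> lies in the isotropic locus, each \<open>f\<close> has \<open>q\<^sup>2 - q\<close> of them, and each \<open>w\<close> occurs
  with at most \<open>q - 1\<close> forms by \<open>card_two_killing\<close>.
\<close>

lemma card_killing_in_isotropic_locus:
  assumes u: "u \<in> isotropic_locus" "u \<noteq> 0"
  shows "int (card {f \<in> U. f u = 0}) * int CARD('k) \<le> int (card isotropic_locus)"
proof -
  let ?q = "int CARD('k)" and ?A = "{f \<in> U. f u = 0}" and ?B = "isotropic_locus - span {u}"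
  have fin: "finite ?A" "finite ?B" "finite (span {u})"
    using U_facts(2) finite_isotropic_locus finite_subset[OF subset_UNIV finite_V] by auto
  have uW: "span {u} \<subseteq> isotropic_locus"
    using u U_facts(4) by (auto simp: span_singleton isotropic_locus_def subset_iff Symm_scale_left Symm_scale_right)
  have cB: "int (card ?B) = int (card isotropic_locus) - ?q"
    using card_Diff_subset[OF fin(3) uW] card_mono[OF finite_isotropic_locus uW] card_span_singleton[OF u(2)]
    by (simp add: of_nat_diff)
  have "int (card {w \<in> ?B. f w = 0}) = ?q ^ 2 - ?q" if f: "f \<in> ?A - {0}" for f
  proof -
    have sub: "span {u} \<subseteq> form_radical f"
      using f U_M M_killing_span[of f u] by (auto simp: M_killing_def form_radical_alt_def)
    have "{w \<in> ?B. f w = 0} = form_radical f - span {u}"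
      using radical_subset_isotropic_locus[of f] f by (auto simp: form_radical_alt_def)
    moreover have "card (span {u}) \<le> card (form_radical f)"
      using finite_subset[OF subset_UNIV finite_V] sub by (intro card_mono)
    moreover have "card (form_radical f) = CARD('k) ^ 2" using f by (intro card_radical_U) auto
    ultimately show ?thesis
      using card_Diff_subset[OF fin(3) sub] card_span_singleton[OF u(2)] by (simp add: of_nat_diff)
  qed
  then have "(\<Sum>f\<in>?A - {0}. int (card {w \<in> ?B. f w = 0})) = int (card (?A - {0})) * (?q ^ 2 - ?q)" by simp
  moreover have "(\<Sum>f\<in>?A - {0}. card {w \<in> ?B. f w = 0}) = (\<Sum>w\<in>?B. card {f \<in> ?A - {0}. f w = 0})"
    by (rule sum_card_swap) (use fin in auto)
  then have "(\<Sum>f\<in>?A - {0}. int (card {w \<in> ?B. f w = 0})) = (\<Sum>w\<in>?B. int (card {f \<in> ?A - {0}. f w = 0}))"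
    by (simp only: flip: of_nat_sum)
  moreover have "(\<Sum>w\<in>?B. int (card {f \<in> ?A - {0}. f w = 0})) \<le> (\<Sum>w\<in>?B. ?q - 1)"
  proof (rule sum_mono)
    fix w assume w: "w \<in> ?B"
    let ?T = "{f \<in> M. f u = 0 \<and> f w = 0}"
    have T: "card ?T = CARD('k)" using card_two_killing[OF u(2)] w by blast
    have "finite ?T" using finite_M by simp
    then have "card {f \<in> ?A - {0}. f w = 0} \<le> card (?T - {0})"
      using U_M by (intro card_mono) auto
    also have "\<dots> = CARD('k) - 1" using T zero_in_M \<open>finite ?T\<close> by (subst card_Diff_singleton) auto
    finally show "int (card {f \<in> ?A - {0}. f w = 0}) \<le> ?q - 1" using q_ge_2 by linarith
  qed
  ultimately have "int (card (?A - {0})) * (?q ^ 2 - ?q) \<le> (int (card isotropic_locus) - ?q) * (?q - 1)"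
    by (simp add: cB)
  moreover have "int (card (?A - {0})) = int (card ?A) - 1"
  proof -
    have "0 \<in> ?A" using U_facts(3) by simp
    then have "card ?A \<ge> 1" using fin(1) by (simp only: Suc_le_eq One_nat_def card_gt_0_iff) blast
    then show ?thesis using \<open>0 \<in> ?A\<close> by (simp only: card_Diff_singleton of_nat_diff of_nat_1)
  qed
  ultimately have "(?q - 1) * (int (card ?A) * ?q - ?q) \<le> (?q - 1) * (int (card isotropic_locus) - ?q)"
    by (simp add: algebra_simps power2_eq_square)
  moreover have "?q - 1 > 0" using q_ge_2 by simp
  ultimately have "int (card ?A) * ?q - ?q \<le> int (card isotropic_locus) - ?q" by (simp only: mult_le_cancel_left_pos)
  then show ?thesis by linarith
qed

text \<open>
  Count the pairs of a non-zero \<open>f\<close> in \<open>U\<close> and a non-zero vector in its radical, which is a plane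
  contained in the isotropic locus.
\<close>

lemma card_bound_isotropic_locus:
  "int CARD('k) * (int (card U) - 1) * (int CARD('k) ^ 2 - 1) \<le>
    (int (card isotropic_locus) - 1) * (int (card isotropic_locus) - int CARD('k))"
proof -
  let ?q = "int CARD('k)" and ?A = "U - {0}" and ?B = "isotropic_locus - {0}"
  have fin: "finite ?A" "finite ?B" using U_facts(2) finite_isotropic_locus by auto
  have W0: "0 \<in> isotropic_locus" using U_facts(4) by (auto simp: isotropic_locus_def Symm_zero_left subset_iff)
  have "card isotropic_locus \<ge> 1" using W0 finite_isotropic_locus by (simp only: Suc_le_eq One_nat_def card_gt_0_iff) blast
  then have cB: "int (card ?B) = int (card isotropic_locus) - 1"
    using W0 by (simp only: card_Diff_singleton of_nat_diff of_nat_1)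
  have "card U \<ge> 1" using U_facts by (simp only: Suc_le_eq One_nat_def card_gt_0_iff) blast
  then have cA: "int (card ?A) = int (card U) - 1"
    using U_facts(3) by (simp only: card_Diff_singleton of_nat_diff of_nat_1)
  have "int (card {w \<in> ?B. f w = 0}) = ?q ^ 2 - 1" if f: "f \<in> ?A" for f
  proof -
    have "{w \<in> ?B. f w = 0} = form_radical f - {0}"
      using radical_subset_isotropic_locus[of f] f by (auto simp: form_radical_alt_def)
    moreover have "0 \<in> form_radical f"
      using f U_facts(4) by (auto simp: form_radical_def Symm_zero_left subset_iff)
    moreover have "card (form_radical f) = CARD('k) ^ 2" using f by (intro card_radical_U) auto
    ultimately have "card {w \<in> ?B. f w = 0} = CARD('k) ^ 2 - 1" by (simp only: card_Diff_singleton)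
    then show ?thesis using q_ge_2 by (simp add: of_nat_diff)
  qed
  then have "(\<Sum>f\<in>?A. int (card {w \<in> ?B. f w = 0})) = int (card ?A) * (?q ^ 2 - 1)" by simp
  moreover have "(\<Sum>f\<in>?A. card {w \<in> ?B. f w = 0}) = (\<Sum>w\<in>?B. card {f \<in> ?A. f w = 0})"
    by (rule sum_card_swap[OF fin])
  then have "(\<Sum>f\<in>?A. int (card {w \<in> ?B. f w = 0})) = (\<Sum>w\<in>?B. int (card {f \<in> ?A. f w = 0}))"
    by (simp only: flip: of_nat_sum)
  ultimately have "?q * (int (card ?A) * (?q ^ 2 - 1)) = (\<Sum>w\<in>?B. ?q * int (card {f \<in> ?A. f w = 0}))"
    by (simp only: flip: sum_distrib_left)
  also have "\<dots> \<le> (\<Sum>w\<in>?B. int (card isotropic_locus) - ?q)"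
  proof (rule sum_mono)
    fix w assume w: "w \<in> ?B"
    let ?C = "{f \<in> U. f w = 0}"
    have C: "0 \<in> ?C" "finite ?C" using U_facts by simp_all
    then have "card ?C \<ge> 1" by (simp only: Suc_le_eq One_nat_def card_gt_0_iff) blast
    then have "int (card (?C - {0})) = int (card ?C) - 1"
      using C by (simp only: card_Diff_singleton of_nat_diff of_nat_1)
    moreover have "{f \<in> ?A. f w = 0} = ?C - {0}" by blast
    ultimately have "?q * int (card {f \<in> ?A. f w = 0}) = int (card ?C) * ?q - ?q"
      by (simp only: right_diff_distrib mult_1_right mult.commute)
    then show "?q * int (card {f \<in> ?A. f w = 0}) \<le> int (card isotropic_locus) - ?q"
      using card_killing_in_isotropic_locus[of w] w by simp
  qed
  also have "\<dots> = (int (card isotropic_locus) - 1) * (int (card isotropic_locus) - ?q)" by (simp add: cB)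
  finally show ?thesis unfolding cA by (simp only: mult.assoc)
qed

text \<open>
  Let \<open>d\<close> be the dimension of \<open>U\<close> and \<open>a = n - d\<close>, so that \<open>U\<close> and the isotropic locus have
  \<open>q ^ d\<close> and \<open>q ^ a\<close> elements. The claim is \<open>d \<le> 2 * a - 3\<close>. If it failed, \<open>q ^ d\<close> would be at least the
  square of \<open>X = q ^ (a - 1)\<close>, and after cancelling \<open>q * (X - 1)\<close> the counting inequality would read
  \<open>(X + 1) * (q\<^sup>2 - 1) \<le> q * X - 1\<close>.
\<close>

lemma dim_constant_rank_bound: "3 * form.dim U + 3 \<le> 2 * n"
proof -
  let ?d = "form.dim U" and ?q = "int CARD('k)"
  have cU: "card U = CARD('k) ^ ?d"
    using finite_field_space.card_subspace[OF finite_field_space_form_scale U_facts(1)] U_facts(2) by blast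
  have q: "?q \<ge> 2" using q_ge_2 by simp
  have d1: "?d \<ge> 1"
  proof (rule ccontr)
    assume "\<not> ?d \<ge> 1"
    then have "card U = 1" using cU by (simp add: not_le)
    then show False using U_facts(3,5) by (metis card_1_singletonE singletonD)
  qed
  have "CARD('k) ^ ?d \<le> CARD('k) ^ n"
    using card_isotropic_locus cU card_V_gt(2) by (metis dvd_imp_le dvd_triv_right)
  then have dn: "?d \<le> n" using q_ge_2 by (simp add: power_le_imp_le_exp)
  define a where "a = n - ?d"
  have "card isotropic_locus * CARD('k) ^ ?d = CARD('k) ^ a * CARD('k) ^ ?d"
    using card_isotropic_locus cU dn by (simp add: a_def flip: power_add)
  then have cW: "card isotropic_locus = CARD('k) ^ a" using q_ge_2 by simp
  have main: "?q * (?q ^ ?d - 1) * (?q ^ 2 - 1) \<le> (?q ^ a - 1) * (?q ^ a - ?q)"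
    using card_bound_isotropic_locus by (simp add: cU cW)
  have "?q ^ 1 \<le> ?q ^ ?d" using q d1 by (intro power_increasing) auto
  then have "?q ^ ?d - 1 > 0" using q by (simp only: power_one_right)
  moreover have "?q ^ 2 - 1 > 0" using q less_1_mult[of ?q ?q] by (simp add: power2_eq_square)
  ultimately have pos: "0 < ?q * (?q ^ ?d - 1) * (?q ^ 2 - 1)" using q by (intro mult_pos_pos) linarith
  have a2: "a \<ge> 2"
  proof (rule ccontr)
    assume "\<not> a \<ge> 2"
    then have "a = 0 \<or> a = 1" by auto
    then show False using main pos by auto
  qed
  define X where "X = ?q ^ (a - 1)"
  have qa: "?q ^ a = ?q * X" using a2 by (simp add: X_def flip: power_Suc)
  have "?q ^ 1 \<le> X" unfolding X_def using q a2 by (intro power_increasing) auto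
  then have X: "X \<ge> 2" using q by simp
  have "?d \<le> 2 * (a - 1) - 1"
  proof (rule ccontr)
    assume "\<not> ?thesis"
    then have "2 * (a - 1) \<le> ?d" by simp
    then have "?q ^ (2 * (a - 1)) \<le> ?q ^ ?d" using q by (intro power_increasing) auto
    then have X2: "X ^ 2 \<le> ?q ^ ?d" by (simp add: X_def power_mult[symmetric] mult.commute)
    have "?q * (X ^ 2 - 1) * (?q ^ 2 - 1) \<le> ?q * (?q ^ ?d - 1) * (?q ^ 2 - 1)"
      using X2 q by (intro mult_right_mono mult_left_mono) (auto simp: power2_eq_square)
    also have "\<dots> \<le> (?q * X - 1) * (?q * X - ?q)" using main by (simp only: qa)
    finally have "(?q * (X - 1)) * ((X + 1) * (?q ^ 2 - 1)) \<le> (?q * (X - 1)) * (?q * X - 1)"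
      by (simp add: algebra_simps power2_eq_square)
    moreover have "?q * (X - 1) > 0" using q X by simp
    ultimately have "(X + 1) * (?q ^ 2 - 1) \<le> ?q * X - 1" by (simp only: mult_le_cancel_left_pos)
    moreover have "(X + 1) * ?q \<le> (X + 1) * (?q ^ 2 - 1)"
    proof (rule mult_left_mono)
      have "?q * 2 \<le> ?q * ?q" using q by (intro mult_left_mono) auto
      then show "?q \<le> ?q ^ 2 - 1" using q by (simp add: power2_eq_square)
    qed (use X in simp)
    ultimately show False using q by (simp add: algebra_simps)
  qed
  then show ?thesis using a2 dn by (simp add: a_def)
qed

end

end

theorem theorem22:
  fixes scale :: "'k::{field, finite} \<Rightarrow> 'v::ab_group_add \<Rightarrow> 'v"
    and n q :: nat
    and M :: "('v \<Rightarrow> 'v \<Rightarrow> 'k) set"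
  assumes "vector_space scale"
    and "vector_space.dim scale (UNIV :: 'v set) = n"
    and "n \<ge> 3" and "odd n"
    and "card (UNIV :: 'k set) = q" and "\<exists>m\<ge>1. q = 2 ^ m"
    and "M \<subseteq> Symm scale" and "form.subspace M" and "form.dim M = 2 * n"
    and "\<forall>f\<in>M. f \<noteq> 0 \<longrightarrow> form_rank scale f \<ge> n - 2"
  shows "(constant_rank_subspace scale (n - 1) (alternating_part M) \<and>
          form.dim (alternating_part M) = n) \<and>
         (q \<ge> n - 1 \<longrightarrow>
           (\<forall>U. U \<subseteq> M \<and> constant_rank_subspace scale (n - 2) U \<longrightarrow>
              real (form.dim U) \<le> (2 * real n - 3) / 3))"
proof -
  interpret V: vector_space scale by (rule assms(1))
  interpret V: finite_field_space scale by unfold_locales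
  have two: "(1::'k) + 1 = 0" using assms(5,6) char_two_of_card_power_two by blast
  interpret V: minimum_rank_space scale n M
    by unfold_locales (use assms two in auto)
  let ?A = "alternating_part M"
  have "?A \<noteq> {0}"
  proof
    assume "?A = {0}"
    then have "CARD('k) ^ n = 1" using V.card_alternating_part by simp
    then show False using V.card_V_gt V.q_ge_2 by simp
  qed
  then have 1: "constant_rank_subspace scale (n - 1) ?A"
    using V.alternating_part_facts V.rank_alternating by (simp add: constant_rank_subspace_def)
  have "CARD('k) ^ form.dim ?A = CARD('k) ^ n"
    using finite_field_space.card_subspace[OF finite_field_space_form_scale V.alternating_part_facts(2)]
      V.alternating_part_facts(3) V.card_alternating_part by simp
  then have 2: "form.dim ?A = n" using V.q_ge_2 by (simp add: power_inject_exp)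
  have 3: "real (form.dim U) \<le> (2 * real n - 3) / 3"
    if "q \<ge> n - 1" "U \<subseteq> M" "constant_rank_subspace scale (n - 2) U" for U
  proof -
    have "3 * form.dim U + 3 \<le> 2 * n" using V.dim_constant_rank_bound[OF that(2,3)] that(1) assms(5) by simp
    then have "real (3 * form.dim U + 3) \<le> real (2 * n)" by (simp only: of_nat_le_iff)
    then show ?thesis by simp
  qed
  show ?thesis using 1 2 3 by blast
qed

end
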